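(* Let $(W,S)$ be a Coxeter system with $W$ finite, let $c$ be a Coxeter element of $W$, and let $\mathscr L$ be a nonempty convex subset of $W$, with $\mathrm{Pro}_c$ defined with respect to $\mathscr L$. Then $\mathrm{Pro}_c^{\mathrm M(c)}(W)=\mathscr L$.
   Context: Let $(W,S)$ be a Coxeter system with $S=\{s_i:i\in I\}$, $I$ a finite index set; $m(i,i')$ is the order of $s_is_{i'}$. The root space is $V=\mathbb R^I$ with standard basis the simple roots $\{\alpha_i:i\in I\}$ and symmetric bilinear form $B(\alpha_i,\alpha_{i'})=-\cos(\pi/m(i,i'))$ (and $-1$ if $m(i,i')=\infty$). $W$ acts on $V$ by $s_i\beta=\beta-2B(\beta,\alpha_i)\alpha_i$. The root system is $\Phi=\{w\alpha_i:w\in W,i\in I\}=\Phi^+\sqcup\Phi^-$, where $\Phi^+$ are the roots that are nonnegative combinations of simple roots and $\Phi^-=-\Phi^+$. For $\beta\in\Phi$ the half-space $H_\beta^+$ is $\{w\in W:w\beta\in\Phi^+\}$. A subset of $W$ is convex if it is an intersection of half-spaces (the empty intersection being $W$). For a nonempty convex set $\mathscr L\subseteq W$ let $\mathrm R(\mathscr L)=\{\beta\in\Phi:\mathscr L\subseteq H_\beta^+\}$. For $i\in I$, the toggle $\tau_i\colon W\to W$ is defined by $\tau_i(u)=u$ if $u^{-1}\alpha_i\in\mathrm R(\mathscr L)$ and $\tau_i(u)=s_iu$ otherwise. A Coxeter element is a product $c=s_{i_n}\cdots s_{i_1}$ where $i_1,\ldots,i_n$ is an ordering of $I$ (each element once);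 $\mathrm{Pro}_c=\tau_{i_n}\cdots\tau_{i_1}$ (composition), which depends only on $c$ and $\mathscr L$. A word is a finite sequence of elements of $I$; it represents the product of the corresponding simple reflections, and is reduced if it has minimum length among words representing that element. Let $w_\circ$ be the long element (the unique element of maximum length) of the finite group $W$. For a reduced word $\mathsf c=i_n\cdots i_1$ for $c$, let $\mathsf c^k$ be the concatenation of $k$ copies of $\mathsf c$. Then $\mathrm M(c)$ is the smallest positive integer $k$ such that $\mathsf c^k$ contains a reduced word for $w_\circ$ as a (not necessarily contiguous) subword; it does not depend on the choice of $\mathsf c$. *)

theory Defs
  imports Complex_Main "HOL-Algebra.Multiplicative_Group" "HOL-Algebra.Generated_Groups"
    "HOL-Library.Sublist"
begin

(* The congruence on words over I generated by (i j)^(m i j) ~ [].  The value 0 encodes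
   m i j = infinity, for which the relation is the trivial [] ~ []. *)
inductive coxeter_equiv :: "'i set \<Rightarrow> ('i \<Rightarrow> 'i \<Rightarrow> nat) \<Rightarrow> 'i list \<Rightarrow> 'i list \<Rightarrow> bool"
  for I :: "'i set" and m :: "'i \<Rightarrow> 'i \<Rightarrow> nat" where
  refl: "coxeter_equiv I m u u"
| sym: "coxeter_equiv I m u v \<Longrightarrow> coxeter_equiv I m v u"
| trans: "coxeter_equiv I m u v \<Longrightarrow> coxeter_equiv I m v w \<Longrightarrow> coxeter_equiv I m u w"
| relator: "i \<in> I \<Longrightarrow> j \<in> I \<Longrightarrow>
    coxeter_equiv I m (u @ concat (replicate (m i j) [i, j]) @ v) (u @ v)"

locale group_with_generators = group G for G (structure) +
  fixes I :: "'i set" and s :: "'i \<Rightarrow> 'a"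
begin

definition m :: "'i \<Rightarrow> 'i \<Rightarrow> nat" where
  "m i j = ord (s i \<otimes> s j)"

definition word_prod :: "'i list \<Rightarrow> 'a" where
  "word_prod ws = foldr (\<lambda>i g. s i \<otimes> g) ws \<one>"

end

(* The last assumption says that (s i s j)^(m i j) = 1 are defining relations.  Since m i i = 1,
   they include [i, i] ~ [], so the monoid presentation is already the group presentation. *)
locale coxeter_system = group_with_generators G I s
  for G (structure) and I :: "'i set" and s :: "'i \<Rightarrow> 'a" +
  assumes finite_I: "finite I"
    and s_carrier: "s \<in> I \<rightarrow> carrier G"
    and s_inj: "inj_on s I"
    and s_order_2: "i \<in> I \<Longrightarrow> ord (s i) = 2"
    and s_generate: "generate G (s ` I) = carrier G"
    and presentation: "ws \<in> lists I \<Longrightarrow> word_prod ws = \<one> \<Longrightarrow> coxeter_equiv I m ws []"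
begin

(* Vectors of the root space V = R^I are functions on the whole type vanishing outside I.
   The set V itself is not needed: every vector occurring below lies in it. *)

definition simple_root :: "'i \<Rightarrow> 'i \<Rightarrow> real" where
  "simple_root i = (\<lambda>j. if j = i then 1 else 0)"

definition B :: "('i \<Rightarrow> real) \<Rightarrow> ('i \<Rightarrow> real) \<Rightarrow> real" where
  "B \<beta> \<gamma> = (\<Sum>i\<in>I. \<Sum>j\<in>I. \<beta> i * \<gamma> j * (if m i j = 0 then - 1 else - cos (pi / real (m i j))))"

definition reflect :: "'i \<Rightarrow> ('i \<Rightarrow> real) \<Rightarrow> ('i \<Rightarrow> real)" where
  "reflect i \<beta> = (\<lambda>j. \<beta> j - 2 * B \<beta> (simple_root i) * simple_root i j)"

(* The action of W determined by the action of the generators: the result does not depend on the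
   word chosen to represent w. *)
definition act :: "'a \<Rightarrow> ('i \<Rightarrow> real) \<Rightarrow> ('i \<Rightarrow> real)" where
  "act w \<beta> = foldr reflect (SOME ws. ws \<in> lists I \<and> word_prod ws = w) \<beta>"

definition roots :: "('i \<Rightarrow> real) set" where
  "roots = {act w (simple_root i) | w i. w \<in> carrier G \<and> i \<in> I}"

definition positive_roots :: "('i \<Rightarrow> real) set" where
  "positive_roots = {\<beta> \<in> roots. \<forall>i\<in>I. 0 \<le> \<beta> i}"

definition half_space :: "('i \<Rightarrow> real) \<Rightarrow> 'a set" where
  "half_space \<beta> = {w \<in> carrier G. act w \<beta> \<in> positive_roots}"

definition convex_subset :: "'a set \<Rightarrow> bool" where
  "convex_subset L \<longleftrightarrow> (\<exists>A \<subseteq> roots. L = carrier G \<inter> (\<Inter>\<beta>\<in>A. half_space \<beta>))"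

definition R :: "'a set \<Rightarrow> ('i \<Rightarrow> real) set" where
  "R L = {\<beta> \<in> roots. L \<subseteq> half_space \<beta>}"

definition toggle :: "'a set \<Rightarrow> 'i \<Rightarrow> 'a \<Rightarrow> 'a" where
  "toggle L i u = (if act (inv u) (simple_root i) \<in> R L then u else s i \<otimes> u)"

(* The list [i_n, ..., i_1] is an ordering of I with c = s i_n ... s i_1. *)
definition coxeter_ordering :: "'i list \<Rightarrow> 'a \<Rightarrow> bool" where
  "coxeter_ordering is c \<longleftrightarrow> distinct is \<and> set is = I \<and> word_prod is = c"

definition coxeter_element :: "'a \<Rightarrow> bool" where
  "coxeter_element c \<longleftrightarrow> (\<exists>is. coxeter_ordering is c)"

(* For the list [i_n, ..., i_1] this is toggle L i_n o ... o toggle L i_1. *)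
definition Pro :: "'a set \<Rightarrow> 'i list \<Rightarrow> 'a \<Rightarrow> 'a" where
  "Pro L is = foldr (toggle L) is"

definition coxeter_length :: "'a \<Rightarrow> nat" where
  "coxeter_length w = (LEAST n. \<exists>ws \<in> lists I. word_prod ws = w \<and> length ws = n)"

definition reduced_word :: "'i list \<Rightarrow> 'a \<Rightarrow> bool" where
  "reduced_word ws w \<longleftrightarrow> ws \<in> lists I \<and> word_prod ws = w \<and> length ws = coxeter_length w"

definition long_element :: 'a where
  "long_element =
    (THE w. w \<in> carrier G \<and> (\<forall>v \<in> carrier G. coxeter_length v \<le> coxeter_length w))"

(* M(c), computed from a word cw for c. *)
definition M :: "'i list \<Rightarrow> nat" where
  "M cw = (LEAST k. 0 < k \<and>
    (\<exists>ws. reduced_word ws long_element \<and> subseq ws (concat (replicate k cw))))"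

end

end

theory Submission
  imports Defs
begin

text \<open>
  Let \<open>i\<^sub>0, i\<^sub>1, \<dots>\<close> be the letters of the powers of \<open>c\<close> in the order in which their toggles are
  applied, let \<open>u\<^sub>t\<close> be the element of \<open>W\<close> reached after \<open>t\<close> toggles, and let \<open>d\<^sub>t\<close> be the greedy
  (Demazure) product of the first \<open>t\<close> letters: \<open>d\<^sub>t\<close> is multiplied on the right by the simple reflection
  of \<open>i\<^sub>t\<close> whenever this increases the length. The invariant is that no root \<open>\<gamma>\<close> in \<open>u\<^sub>t R(L)\<close> has \<open>\<gamma> < 0\<close> and
  \<open>d\<^sub>t \<gamma> > 0\<close>. It holds trivially for \<open>d\<^sub>0 = 1\<close>, and as soon as \<open>d\<^sub>t\<close> is the long element it says that
  \<open>u\<^sub>t\<close> lies in \<open>L\<close>. It is preserved at a letter that the greedy product uses because \<open>R(L)\<close> is closed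
  under nonnegative combinations. At a skipped letter \<open>i\<close> it is preserved if \<open>d\<^sub>t\<close> sends
  \<open>\<alpha>\<^sub>i\<close> to the negative of a simple root.

  The latter holds for powers of a Coxeter element, because a letter that does not commute with \<open>i\<close> (or is
  \<open>i\<close> itself) is never used after \<open>i\<close> has been skipped: then \<open>d\<^sub>t \<alpha>\<^sub>i\<close> already has its final value
  \<open>w\<^sub>\<circ> \<alpha>\<^sub>i\<close>. To see this, compare with the greedy word of the rotated Coxeter element. By induction,
  a first violation occurs only if \<open>i\<close> is used in the rotated word, and this forces \<open>d\<^sub>t \<alpha>\<^sub>i = - \<alpha>\<^sub>h\<close>
  for the first letter \<open>h\<close> of \<open>c\<close>. The Euler form of \<open>c\<close> is transported by \<open>d\<^sub>t\<close> to that of a rotation,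
  so if \<open>j\<close> is a neighbour of \<open>i\<close> that is used later, at a time when the greedy product is \<open>d\<close>, then the
  positive root \<open>d \<alpha>\<^sub>j\<close> has no \<open>\<alpha>\<^sub>h\<close>-component, contradicting \<open>B(d \<alpha>\<^sub>j, \<alpha>\<^sub>h) = - B(\<alpha>\<^sub>j, \<alpha>\<^sub>i) > 0\<close>.
\<close>

section \<open>Words in a finite Coxeter group\<close>

locale finite_coxeter_system = coxeter_system G I s
  for G (structure) and I :: "'i set" and s :: "'i \<Rightarrow> 'a" +
  assumes finite_carrier: "finite (carrier G)"
begin

lemma s_closed [simp]: "i \<in> I \<Longrightarrow> s i \<in> carrier G"
  using s_carrier by auto

lemma s_square: "i \<in> I \<Longrightarrow> s i \<otimes> s i = \<one>"
  using pow_ord_eq_1[of "s i"] s_order_2[of i] by (simp add: numeral_2_eq_2)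

lemma s_cancel: "i \<in> I \<Longrightarrow> w \<in> carrier G \<Longrightarrow> s i \<otimes> (s i \<otimes> w) = w"
  by (simp add: s_square flip: m_assoc)

lemma s_inv: "i \<in> I \<Longrightarrow> inv (s i) = s i"
  by (simp add: inv_equality s_square)

lemma word_prod_Nil [simp]: "word_prod [] = \<one>"
  by (simp add: word_prod_def)

lemma word_prod_Cons [simp]: "word_prod (i # ws) = s i \<otimes> word_prod ws"
  by (simp add: word_prod_def)

lemma word_prod_closed [simp]: "ws \<in> lists I \<Longrightarrow> word_prod ws \<in> carrier G"
  by (induction ws) auto

lemma word_prod_append:
  "us \<in> lists I \<Longrightarrow> vs \<in> lists I \<Longrightarrow> word_prod (us @ vs) = word_prod us \<otimes> word_prod vs"
  by (induction us) (auto simp: m_assoc)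

lemma word_prod_rev: "ws \<in> lists I \<Longrightarrow> word_prod (rev ws) = inv (word_prod ws)"
proof (induction ws)
  case (Cons i ws)
  then have "rev ws \<in> lists I" by auto
  with Cons show ?case
    by (auto simp: word_prod_append s_inv inv_mult_group)
qed simp

text \<open>Generators are their own inverses, so words need no inverse letters.\<close>

lemma ex_word:
  assumes "w \<in> carrier G"
  obtains ws where "ws \<in> lists I" "word_prod ws = w"
proof -
  have "w \<in> generate G (s ` I)" using assms s_generate by simp
  then have "\<exists>ws\<in>lists I. word_prod ws = w"
  proof induction
    case one
    show ?case by (rule bexI[of _ "[]"]) auto
  next
    case (incl h)
    then obtain i where "i \<in> I" "h = s i" by auto
    then show ?case by (intro bexI[of _ "[i]"]) auto
  next
    case (inv h)
    then obtain i where "i \<in> I" "h = s i" by auto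
    then show ?case by (intro bexI[of _ "[i]"]) (auto simp: s_inv)
  next
    case (eng g h)
    then obtain us vs where "us \<in> lists I" "word_prod us = g" "vs \<in> lists I" "word_prod vs = h"
      by auto
    then show ?case by (intro bexI[of _ "us @ vs"]) (auto simp: word_prod_append)
  qed
  then show thesis using that by auto
qed

lemma m_pos: "i \<in> I \<Longrightarrow> j \<in> I \<Longrightarrow> m i j > 0"
  using ord_ge_1[OF finite_carrier, of "s i \<otimes> s j"] by (simp add: m_def)

lemma m_self: "i \<in> I \<Longrightarrow> m i i = 1"
  by (simp add: m_def s_square)

lemma m_sym: "i \<in> I \<Longrightarrow> j \<in> I \<Longrightarrow> m i j = m j i"
proof -
  assume ij: "i \<in> I" "j \<in> I"
  have "s j \<otimes> s i = inv (s i \<otimes> s j)" using ij by (simp add: inv_mult_group s_inv)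
  then show ?thesis using ij by (simp add: m_def)
qed

lemma m_ge_2: "i \<in> I \<Longrightarrow> j \<in> I \<Longrightarrow> i \<noteq> j \<Longrightarrow> m i j \<ge> 2"
proof -
  assume ij: "i \<in> I" "j \<in> I" "i \<noteq> j"
  have "s i \<otimes> s j \<noteq> \<one>"
  proof
    assume "s i \<otimes> s j = \<one>"
    then have "s i = s j" using ij s_inv[of j] inv_equality[of "s i" "s j"] by simp
    then show False using ij s_inj by (auto dest: inj_onD)
  qed
  then have "m i j \<noteq> 1" using ij ord_eq_1[of "s i \<otimes> s j"] by (simp add: m_def)
  then show ?thesis using m_pos[of i j] ij by simp
qed

section \<open>The bilinear form and its reflections\<close>

definition gram :: "'i \<Rightarrow> 'i \<Rightarrow> real" where
  "gram i j = (if m i j = 0 then - 1 else - cos (pi / real (m i j)))"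

lemma gram_self: "i \<in> I \<Longrightarrow> gram i i = 1"
  by (simp add: gram_def m_self)

lemma gram_sym: "i \<in> I \<Longrightarrow> j \<in> I \<Longrightarrow> gram i j = gram j i"
  by (simp add: gram_def m_sym)

lemma gram_nonpos: 
  assumes "i \<in> I" "j \<in> I" "i \<noteq> j"
  shows "gram i j \<le> 0"
proof -
  have "m i j \<ge> 2" using m_ge_2 assms by simp
  then have "pi / real (m i j) \<le> pi / 2" by (intro divide_left_mono) auto
  moreover have "0 \<le> pi / real (m i j)" by simp
  ultimately have "cos (pi / real (m i j)) \<ge> 0" by (intro cos_ge_zero) linarith+
  then show ?thesis by (simp add: gram_def)
qed

lemma B_gram: "B \<beta> \<gamma> = (\<Sum>i\<in>I. \<Sum>j\<in>I. \<beta> i * \<gamma> j * gram i j)"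
  by (simp add: B_def gram_def)

text \<open>Linearity is expressed through this one binary operation; sums, multiples and negation
  are special cases, so a single law per map suffices.\<close>

definition lincomb :: "real \<Rightarrow> ('i \<Rightarrow> real) \<Rightarrow> real \<Rightarrow> ('i \<Rightarrow> real) \<Rightarrow> ('i \<Rightarrow> real)" where
  "lincomb a \<beta> b \<gamma> = (\<lambda>j. a * \<beta> j + b * \<gamma> j)"

lemma B_sym: "B \<beta> \<gamma> = B \<gamma> \<beta>"
proof -
  have "B \<beta> \<gamma> = (\<Sum>j\<in>I. \<Sum>i\<in>I. \<beta> i * \<gamma> j * gram i j)"
    unfolding B_gram by (rule sum.swap)
  also have "\<dots> = B \<gamma> \<beta>"
    unfolding B_gram by (intro sum.cong[OF HOL.refl]) (simp add: gram_sym)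
  finally show ?thesis .
qed

lemma B_lincomb_left: "B (lincomb a \<beta> b \<gamma>) \<delta> = a * B \<beta> \<delta> + b * B \<gamma> \<delta>"
  unfolding B_gram lincomb_def sum_distrib_left sum.distrib[symmetric]
  by (intro sum.cong[OF HOL.refl]) (simp add: algebra_simps)

lemma B_lincomb_right: "B \<delta> (lincomb a \<beta> b \<gamma>) = a * B \<delta> \<beta> + b * B \<delta> \<gamma>"
  by (simp add: B_sym[of \<delta>] B_lincomb_left)

lemma uminus_lincomb: "- \<beta> = lincomb (- 1) \<beta> 0 \<beta>"
  by (auto simp: lincomb_def)

lemma B_minus_right: "B \<beta> (- \<gamma>) = - B \<beta> \<gamma>"
  by (simp add: uminus_lincomb B_lincomb_right)

lemma B_simple: 
  assumes "i \<in> I" shows "B \<beta> (simple_root i) = (\<Sum>k\<in>I. \<beta> k * gram k i)"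
  unfolding B_gram simple_root_def
proof (intro sum.cong[OF HOL.refl])
  fix k
  have "(\<Sum>j\<in>I. \<beta> k * (if j = i then 1 else 0) * gram k j) = (\<Sum>j\<in>I. if j = i then \<beta> k * gram k j else 0)"
    by (intro sum.cong[OF HOL.refl]) auto
  then show "(\<Sum>j\<in>I. \<beta> k * (if j = i then 1 else 0) * gram k j) = \<beta> k * gram k i"
    using assms finite_I by simp
qed

lemma B_simple_simple: 
  assumes "i \<in> I" "j \<in> I" shows "B (simple_root i) (simple_root j) = gram i j"
proof -
  have "B (simple_root i) (simple_root j) = (\<Sum>k\<in>I. if k = i then gram k j else 0)"
    unfolding B_simple[OF assms(2)] by (intro sum.cong[OF HOL.refl]) (auto simp: simple_root_def)
  then show ?thesis using assms finite_I by simp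
qed

text \<open>For a vector of norm 1 this is the orthogonal reflection that negates it.\<close>

definition refl_root :: "('i \<Rightarrow> real) \<Rightarrow> ('i \<Rightarrow> real) \<Rightarrow> ('i \<Rightarrow> real)" where
  "refl_root \<beta> \<gamma> = lincomb 1 \<gamma> (- 2 * B \<gamma> \<beta>) \<beta>"

lemma reflect_refl_root: "reflect i = refl_root (simple_root i)"
  by (rule ext) (simp add: reflect_def refl_root_def lincomb_def)

lemma reflect_lincomb: "reflect i \<beta> = lincomb 1 \<beta> (- 2 * B \<beta> (simple_root i)) (simple_root i)"
  by (simp add: reflect_refl_root refl_root_def)

lemma refl_root_lincomb:
  "refl_root \<delta> (lincomb a \<beta> b \<gamma>) = lincomb a (refl_root \<delta> \<beta>) b (refl_root \<delta> \<gamma>)"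
  by (rule ext) (simp add: refl_root_def B_lincomb_left, simp add: lincomb_def algebra_simps)

lemma B_refl_root: "B \<delta> \<delta> = 1 \<Longrightarrow> B (refl_root \<delta> \<beta>) (refl_root \<delta> \<gamma>) = B \<beta> \<gamma>"
  by (simp add: refl_root_def B_lincomb_left B_lincomb_right B_sym[of \<delta> \<gamma>])

lemma refl_root_invol: "B \<delta> \<delta> = 1 \<Longrightarrow> refl_root \<delta> (refl_root \<delta> \<beta>) = \<beta>"
  by (rule ext) (simp add: refl_root_def B_lincomb_left, simp add: lincomb_def algebra_simps)

lemma refl_root_self: "B \<delta> \<delta> = 1 \<Longrightarrow> refl_root \<delta> \<delta> = - \<delta>"
  by (rule ext) (simp add: refl_root_def lincomb_def)

text \<open>The action of a word, available before the action of the group is known to be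
  independent of words; \<open>wact_cong\<close> shows this independence and
  \<open>act_word_prod\<close> then removes the choice in \<open>act\<close>.\<close>

abbreviation wact :: "'i list \<Rightarrow> ('i \<Rightarrow> real) \<Rightarrow> ('i \<Rightarrow> real)" where
  "wact ws \<equiv> foldr reflect ws"

lemma wact_lincomb: "wact ws (lincomb a \<beta> b \<gamma>) = lincomb a (wact ws \<beta>) b (wact ws \<gamma>)"
  by (induction ws) (auto simp: reflect_refl_root refl_root_lincomb)

lemma wact_minus: "wact ws (- \<beta>) = - wact ws \<beta>"
  unfolding uminus_lincomb by (simp only: wact_lincomb)

lemma B_simple_self: "i \<in> I \<Longrightarrow> B (simple_root i) (simple_root i) = 1"
  by (simp add: B_simple_simple gram_self)

lemma B_wact: "ws \<in> lists I \<Longrightarrow> B (wact ws \<beta>) (wact ws \<gamma>) = B \<beta> \<gamma>"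
  by (induction ws) (auto simp: reflect_refl_root B_refl_root B_simple_self)

lemma reflect_reflect: "i \<in> I \<Longrightarrow> reflect i (reflect i \<beta>) = \<beta>"
  by (simp add: reflect_refl_root refl_root_invol B_simple_self)

lemma reflect_simple: "i \<in> I \<Longrightarrow> reflect i (simple_root i) = - simple_root i"
  by (simp add: reflect_refl_root refl_root_self B_simple_self)

lemma wact_rev: "ws \<in> lists I \<Longrightarrow> wact (rev ws) (wact ws \<beta>) = \<beta>"
  by (induction ws arbitrary: \<beta>) (auto simp: reflect_reflect)

lemma wact_rev': "ws \<in> lists I \<Longrightarrow> wact ws (wact (rev ws) \<beta>) = \<beta>"
  using wact_rev[of "rev ws" \<beta>] by (simp add: in_lists_conv_set)

text \<open>The alternating word ends in its second letter, hence \<open>i\<close> can be appended to \<open>alt i j n\<close>.\<close>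

fun alt :: "'i \<Rightarrow> 'i \<Rightarrow> nat \<Rightarrow> 'i list" where
  "alt i j 0 = []"
| "alt i j (Suc n) = (if even n then j else i) # alt i j n"

lemma length_alt [simp]: "length (alt i j n) = n"
  by (induction n) auto

lemma alt_lists: "i \<in> I \<Longrightarrow> j \<in> I \<Longrightarrow> alt i j n \<in> lists I"
  by (induction n) auto

lemma alt_replicate: "concat (replicate n [i, j]) = alt i j (2 * n)"
  by (induction n) auto

lemma alt_Suc_snoc: "alt i j (Suc n) = alt j i n @ [j]"
  by (induction n) auto

text \<open>Equal parity of \<open>p\<close> and \<open>q\<close> makes the two letters at the
  junction differ. With \<open>p = q = m i j\<close> this splits the relator into two alternating
  halves.\<close>

lemma rev_alt_append: "even (p + q) \<Longrightarrow> rev (alt j i p) @ alt i j q = alt i j (p + q)"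
proof (induction p arbitrary: q)
  case (Suc p)
  have "rev (alt j i (Suc p)) @ alt i j q = rev (alt j i p) @ alt i j (Suc q)"
    using Suc.prems by auto
  also have "\<dots> = alt i j (p + Suc q)" using Suc by (intro Suc.IH) simp
  finally show ?case by simp
qed simp

section \<open>Dihedral action on a pair of simple roots\<close>

lemma sin_recurrence: "2 * cos t * sin (real (Suc n) * t) - sin (real n * t) = sin (real (Suc (Suc n)) * t)"
proof -
  have "sin (real (Suc (Suc n)) * t) = sin (real (Suc n) * t + t)"
    "sin (real n * t) = sin (real (Suc n) * t - t)" by (simp_all add: algebra_simps)
  then show ?thesis by (simp only: sin_add sin_diff) simp
qed

lemma reflect_lincomb_simple:
  assumes "i \<in> I" "j \<in> I"
  shows "reflect j (lincomb a (simple_root i) b (simple_root j)) =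
    lincomb a (simple_root i) (- 2 * gram i j * a - b) (simple_root j)"
  unfolding reflect_lincomb B_lincomb_left B_simple_simple[OF assms] B_simple_self[OF assms(2)]
  by (rule ext) (simp add: lincomb_def algebra_simps)

lemma lincomb_commute: "lincomb a \<beta> b \<gamma> = lincomb b \<gamma> a \<beta>"
  by (auto simp: lincomb_def)

lemma
  assumes "i \<in> I" "j \<in> I" "i \<noteq> j"
  defines "t \<equiv> pi / real (m i j)"
  shows sin_pos: "sin t > 0" and gram_cos: "gram i j = - cos t"
proof -
  have m2: "m i j \<ge> 2" using assms m_ge_2 by simp
  have "0 < t" "t < pi" using m2 unfolding t_def by (auto simp: field_simps)
  then show "sin t > 0" by (rule sin_gt_zero)
  show "gram i j = - cos t"
    using m2 by (auto simp: gram_def t_def)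
qed

text \<open>Each letter changes one of the two coefficients, by the three-term recurrence of the
  sines of multiples of \<open>t\<close>. The parity of \<open>n\<close> tells which coefficient
  changed last.\<close>

lemma wact_alt:
  assumes "i \<in> I" "j \<in> I" "i \<noteq> j"
  defines "t \<equiv> pi / real (m i j)"
  shows "wact (alt i j n) (simple_root i) =
    (if even n then lincomb (sin (real (Suc n) * t) / sin t) (simple_root i) (sin (real n * t) / sin t) (simple_root j)
     else lincomb (sin (real n * t) / sin t) (simple_root i) (sin (real (Suc n) * t) / sin t) (simple_root j))"
    (is "_ = ?R n")
proof (induction n)
  have st: "sin t \<noteq> 0" using sin_pos[OF assms(1-3)] by (simp add: t_def)
  have g: "gram i j = - cos t" "gram j i = - cos t"
    using gram_cos[OF assms(1-3)] gram_sym[OF assms(1,2)] by (simp_all add: t_def)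
  case 0
  then show ?case using st by (auto simp: lincomb_def)
  case (Suc n)
  have e: "2 * cos t * sin (real (Suc n) * t) / sin t - sin (real n * t) / sin t = sin (real (Suc (Suc n)) * t) / sin t"
    unfolding sin_recurrence[symmetric] by (simp add: diff_divide_distrib)
  show ?case
  proof (cases "even n")
    case True
    have "wact (alt i j (Suc n)) (simple_root i) = reflect j (?R n)" using True Suc by simp
    also have "\<dots> = ?R (Suc n)"
      using True by (simp add: reflect_lincomb_simple[OF assms(1,2)] g e del: of_nat_Suc)
    finally show ?thesis .
  next
    case False
    have "wact (alt i j (Suc n)) (simple_root i) = reflect i (?R n)" using False Suc by simp
    also have "\<dots> = ?R (Suc n)"
      using False
      by (simp add: lincomb_commute[of _ "simple_root i"] reflect_lincomb_simple[OF assms(2,1)] g e del: of_nat_Suc)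
    finally show ?thesis .
  qed
qed

section \<open>Positivity of roots\<close>

lemma wact_orthogonal:
  "ws \<in> lists J \<Longrightarrow> (\<And>j. j \<in> J \<Longrightarrow> B \<beta> (simple_root j) = 0) \<Longrightarrow> wact ws \<beta> = \<beta>"
  by (induction ws) (auto simp: reflect_lincomb lincomb_def)

text \<open>The relator fixes both simple roots by the sine formula, and it fixes everything
  orthogonal to them. The form is nondegenerate on their span, so these vectors together give all of
  the space.\<close>

lemma wact_relator:
  assumes ij: "i \<in> I" "j \<in> I"
  shows "wact (concat (replicate (m i j) [i, j])) \<beta> = \<beta>"
proof (cases "i = j")
  case True
  then show ?thesis using ij by (simp add: m_self reflect_reflect)
next
  case False
  define t where "t = pi / real (m i j)"
  define F where "F = wact (concat (replicate (m i j) [i, j]))"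
  have m0: "m i j \<ge> 2" using m_ge_2 ij False by simp
  then have mt: "real (m i j) * t = pi" by (simp add: t_def)
  have F_lin: "F (lincomb a \<gamma> b \<delta>) = lincomb a (F \<gamma>) b (F \<delta>)" for a b \<gamma> \<delta>
    unfolding F_def by (rule wact_lincomb)
  have st: "sin t > 0" using sin_pos[OF ij False] by (simp add: t_def)
  have g: "gram i j = - cos t" "gram j i = - cos t"
    using gram_cos[OF ij False] gram_sym[OF ij] by (simp_all add: t_def)
  have mt2: "2 * real (m i j) * t = 2 * pi" and "real (Suc (2 * m i j)) * t = 2 * pi + t"
    using mt by (simp_all add: algebra_simps)
  moreover have "sin (2 * real (m i j) * t) = 0" by (simp only: mt2 sin_two_pi)
  ultimately have Fi: "F (simple_root i) = simple_root i"
    using st unfolding F_def alt_replicate wact_alt[OF ij False] t_def[symmetric]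
    by (simp add: lincomb_def sin_add del: of_nat_Suc)
  \<comment> \<open>The rightmost letter \<open>j\<close> acts first and negates its own root; what
    remains is an alternating word of odd length, to which the sine formula applies.\<close>
  obtain k where k: "2 * m i j = Suc (Suc (2 * k))" using m0 by (cases "m i j") auto
  have kt: "real (Suc (Suc (2 * k))) * t = 2 * pi" using mt k[symmetric] by simp
  then have kt': "real (Suc (2 * k)) * t = 2 * pi - t" by (simp add: algebra_simps)
  have t': "pi / real (m j i) = t" by (simp add: t_def m_sym[OF ij])
  have "wact (alt j i (Suc (2 * k))) (simple_root j) = - simple_root j"
    unfolding wact_alt[OF ij(2,1) False[symmetric]] t'
    using st kt kt' by (simp add: lincomb_def sin_diff fun_eq_iff del: of_nat_Suc)
  then have Fj: "F (simple_root j) = simple_root j"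
    unfolding F_def alt_replicate k alt_Suc_snoc[of i j "Suc (2 * k)"] foldr_append
    using ij by (simp add: reflect_simple wact_minus fun_eq_iff del: alt.simps)
  define x y where "x = B \<beta> (simple_root i)" and "y = B \<beta> (simple_root j)"
  \<comment> \<open>The solution of the two linear equations that make \<delta> orthogonal to both
    simple roots; the Gram determinant is the square of \<open>sin t\<close>.\<close>
  define p q where "p = (x + cos t * y) / (sin t)\<^sup>2" and "q = (y + cos t * x) / (sin t)\<^sup>2"
  define \<gamma> where "\<gamma> = lincomb p (simple_root i) q (simple_root j)"
  define \<delta> where "\<delta> = lincomb 1 \<beta> (-1) \<gamma>"
  have c2: "(cos t)\<^sup>2 = 1 - (sin t)\<^sup>2" by (simp add: cos_squared_eq)
  have "p - cos t * q = (x * (1 - (cos t)\<^sup>2)) / (sin t)\<^sup>2"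
    unfolding p_def q_def by (simp add: field_simps power2_eq_square diff_divide_distrib[symmetric])
  also have "\<dots> = x" using st by (simp add: c2)
  finally have px: "p - cos t * q = x" .
  have "q - cos t * p = (y * (1 - (cos t)\<^sup>2)) / (sin t)\<^sup>2"
    unfolding p_def q_def by (simp add: field_simps power2_eq_square diff_divide_distrib[symmetric])
  also have "\<dots> = y" using st by (simp add: c2)
  finally have qy: "q - cos t * p = y" .
  have "B \<delta> (simple_root i) = 0" "B \<delta> (simple_root j) = 0"
    unfolding \<delta>_def \<gamma>_def B_lincomb_left using px qy
    by (simp_all add: B_simple_self B_simple_simple ij g x_def[symmetric] y_def[symmetric] algebra_simps)
  moreover have "concat (replicate n [i, j]) \<in> lists {i, j}" for n
    by (induction n) auto
  ultimately have Fd: "F \<delta> = \<delta>"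
    unfolding F_def by (intro wact_orthogonal[where J = "{i, j}"]) auto
  have F\<gamma>: "F \<gamma> = \<gamma>" unfolding \<gamma>_def F_lin Fi Fj ..
  have b: "\<beta> = lincomb 1 \<delta> 1 \<gamma>" by (simp add: \<delta>_def lincomb_def)
  have "F \<beta> = F (lincomb 1 \<delta> 1 \<gamma>)" by (simp only: b[symmetric])
  also have "\<dots> = \<beta>" unfolding F_lin Fd F\<gamma> by (rule b[symmetric])
  finally have "F \<beta> = \<beta>" .
  then show ?thesis by (simp add: F_def)
qed

lemma wact_equiv: "coxeter_equiv I m us vs \<Longrightarrow> wact us = wact vs"
proof (induction rule: coxeter_equiv.induct)
  case (relator i j us vs)
  have "wact (concat (replicate (m i j) [i, j])) = id"
    using wact_relator[OF relator] by auto
  then show ?case by (auto simp only: foldr_append comp_apply id_apply)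
qed auto

text \<open>One word followed by the reverse of the other represents the identity, so the
  presentation reduces it to the empty word, and relators act trivially.\<close>

lemma wact_cong:
  assumes "us \<in> lists I" "vs \<in> lists I" "word_prod us = word_prod vs"
  shows "wact us = wact vs"
proof
  fix \<beta>
  have rv: "rev vs \<in> lists I" using assms(2) by auto
  have "word_prod (us @ rev vs) = \<one>"
    using assms rv by (simp add: word_prod_append word_prod_rev)
  then have "coxeter_equiv I m (us @ rev vs) []"
    using presentation[of "us @ rev vs"] assms(1) rv by auto
  then have "wact (us @ rev vs) = wact []" by (rule wact_equiv)
  then have "wact (us @ rev vs) (wact vs \<beta>) = wact vs \<beta>" by (simp only: foldr.simps id_apply)
  then show "wact us \<beta> = wact vs \<beta>" using wact_rev[OF assms(2)] by simp
qed

lemma act_word_prod: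
  assumes "ws \<in> lists I" shows "act (word_prod ws) = wact ws"
proof
  fix \<beta>
  define us where "us = (SOME us. us \<in> lists I \<and> word_prod us = word_prod ws)"
  have "us \<in> lists I \<and> word_prod us = word_prod ws"
    unfolding us_def by (rule someI[of _ ws]) (use assms in auto)
  then have "wact us = wact ws" using wact_cong assms by blast
  then show "act (word_prod ws) \<beta> = wact ws \<beta>" by (simp add: act_def us_def)
qed

lemma act_mult:
  assumes "v \<in> carrier G" "w \<in> carrier G" shows "act (v \<otimes> w) \<beta> = act v (act w \<beta>)"
proof -
  obtain us vs where "us \<in> lists I" "word_prod us = v" "vs \<in> lists I" "word_prod vs = w"
    using ex_word assms by metis
  then show ?thesis using act_word_prod[of us] act_word_prod[of vs] act_word_prod[of "us @ vs"]
    by (auto simp: word_prod_append)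
qed

lemma act_one: "act \<one> \<beta> = \<beta>"
  using act_word_prod[of "[]"] by simp

lemma act_s: "i \<in> I \<Longrightarrow> act (s i) = reflect i"
  using act_word_prod[of "[i]"] by auto

lemma act_inv_act: "w \<in> carrier G \<Longrightarrow> act (inv w) (act w \<beta>) = \<beta>"
  by (simp add: act_mult[symmetric] act_one)

lemma act_act_inv: "w \<in> carrier G \<Longrightarrow> act w (act (inv w) \<beta>) = \<beta>"
  by (simp add: act_mult[symmetric] act_one)

section \<open>Length and braid relations\<close>

lemma coxeter_length_le: "ws \<in> lists I \<Longrightarrow> coxeter_length (word_prod ws) \<le> length ws"
  unfolding coxeter_length_def by (rule Least_le) auto

lemma ex_reduced_word:
  assumes "w \<in> carrier G" obtains ws where "reduced_word ws w"
proof -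
  have "\<exists>n. \<exists>ws\<in>lists I. word_prod ws = w \<and> length ws = n"
    using ex_word[OF assms] by metis
  from LeastI_ex[OF this] show thesis
    using that unfolding reduced_word_def coxeter_length_def by blast
qed

lemma coxeter_length_mult_le:
  assumes "v \<in> carrier G" "us \<in> lists I"
  shows "coxeter_length (v \<otimes> word_prod us) \<le> coxeter_length v + length us"
proof -
  obtain vs where "reduced_word vs v" using ex_reduced_word assms(1) by blast
  then show ?thesis
    using coxeter_length_le[of "vs @ us"] assms by (auto simp: reduced_word_def word_prod_append)
qed

lemma word_prod_replicate:
  "i \<in> I \<Longrightarrow> j \<in> I \<Longrightarrow> word_prod (concat (replicate n [i, j])) = (s i \<otimes> s j) [^] n"
proof (induction n)
  case (Suc n)
  then show ?case by (subst nat_pow_Suc2) (simp_all add: m_assoc)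
qed simp

text \<open>Half of the letters of the relator are moved to the other side.\<close>

lemma braid_relation:
  assumes "i \<in> I" "j \<in> I"
  shows "word_prod (alt i j (m i j)) = word_prod (alt j i (m i j))"
proof -
  note l = alt_lists[OF assms, of "m i j"] alt_lists[OF assms(2,1), of "m i j"]
  then have r: "rev (alt j i (m i j)) \<in> lists I" by auto
  have "rev (alt j i (m i j)) @ alt i j (m i j) = concat (replicate (m i j) [i, j])"
    by (simp add: rev_alt_append alt_replicate mult_2)
  moreover have "word_prod (concat (replicate (m i j) [i, j])) = \<one>"
    using assms pow_ord_eq_1[of "s i \<otimes> s j"] by (simp add: word_prod_replicate m_def)
  ultimately have "inv (word_prod (alt j i (m i j))) \<otimes> word_prod (alt i j (m i j)) = \<one>"
    using l r by (metis word_prod_append word_prod_rev)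
  then have "inv (inv (word_prod (alt j i (m i j)))) = word_prod (alt i j (m i j))"
    using l by (metis inv_closed inv_equality inv_inv word_prod_closed)
  then show ?thesis using l by simp
qed

text \<open>With two letters and no doubled letter, each letter is forced by its successor, starting
  from the last one.\<close>

lemma alternating_eq_alt:
  assumes "u \<in> lists {i, j}" "i \<noteq> j" "\<And>us a vs. u \<noteq> us @ [a, a] @ vs" "u = [] \<or> last u = j"
  shows "u = alt i j (length u)"
  using assms
proof (induction u rule: list.induct)
  case (Cons a u)
  define n where "n = length u"
  have IH: "u = alt i j n"
    unfolding n_def
  proof (rule Cons.IH)
    show "u \<in> lists {i, j}" using Cons.prems(1) by simp
    show "u = [] \<or> last u = j" using Cons.prems(4) by (cases "u = []") auto
    show "u \<noteq> us @ [b, b] @ vs" for us b vs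
      using Cons.prems(3)[of "a # us" b vs] by simp
  qed (fact Cons.prems)
  have "a = (if even n then j else i)"
  proof (cases u)
    case Nil
    then show ?thesis using Cons.prems by (auto simp: n_def)
  next
    case u: (Cons b v)
    have "a \<noteq> b" using Cons.prems(3)[of "[]" a v] u by auto
    moreover have n: "n = Suc (length v)" using u by (simp add: n_def)
    moreover have "b = (if even (length v) then j else i)" using IH u unfolding n by simp
    moreover have "a \<in> {i, j}" using Cons.prems(1) by simp
    ultimately show ?thesis using \<open>i \<noteq> j\<close> by (auto split: if_splits)
  qed
  then have eq: "a # u = alt i j (Suc n)" using IH by simp
  have len: "length (a # u) = Suc n" by (simp add: n_def)
  show ?case unfolding len by (rule eq)
qed simp

lemma alt_split: "k \<le> n \<Longrightarrow> \<exists>us \<in> lists {i, j}. alt i j n = us @ alt i j k"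
proof (induction n)
  case (Suc n)
  show ?case
  proof (cases "k = Suc n")
    case False
    then obtain us where "us \<in> lists {i, j}" "alt i j n = us @ alt i j k" using Suc by auto
    then show ?thesis by (intro bexI[of _ "(if even n then j else i) # us"]) auto
  qed auto
qed auto

text \<open>The angles that occur are at most \<open>m i j\<close> times \<open>t\<close>, which is
  \<pi>, so their sines are nonnegative.\<close>

lemma wact_alt_nonneg:
  assumes "i \<in> I" "j \<in> I" "i \<noteq> j" "n < m i j"
  obtains a b where "a \<ge> 0" "b \<ge> 0"
    "wact (alt i j n) (simple_root i) = lincomb a (simple_root i) b (simple_root j)"
proof -
  define t where "t = pi / real (m i j)"
  have st: "sin t > 0" using sin_pos[OF assms(1-3)] by (simp add: t_def)
  have *: "sin (real k * t) / sin t \<ge> 0" if "k \<le> m i j" for k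
  proof -
    have "real k * t \<le> real (m i j) * t" unfolding t_def using that by (intro mult_right_mono) auto
    also have "\<dots> = pi" unfolding t_def using assms(4) by simp
    finally have "sin (real k * t) \<ge> 0" by (intro sin_ge_zero) (auto simp: t_def)
    then show ?thesis using st by simp
  qed
  show thesis
  proof (cases "even n")
    case True
    then show thesis
      using that[of "sin (real (Suc n) * t) / sin t" "sin (real n * t) / sin t"] *[of n] *[of "Suc n"] assms(4)
        wact_alt[OF assms(1-3), of n] by (simp add: t_def[symmetric])
  next
    case False
    then show thesis
      using that[of "sin (real n * t) / sin t" "sin (real (Suc n) * t) / sin t"] *[of n] *[of "Suc n"] assms(4)
        wact_alt[OF assms(1-3), of n] by (simp add: t_def[symmetric])
  qed
qed

text \<open>Induction on the length. Let \<open>j\<close> be the last letter of a reduced word for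
  \<open>w\<close>, and split off from the right of \<open>w\<close> a longest possible factor
  \<open>u\<close> in the letters \<open>i\<close> and \<open>j\<close>, with lengths adding up. The
  rest \<open>v\<close> is shorter and sends both simple roots to nonnegative vectors, while
  \<open>u\<close> sends that of \<open>i\<close> to a nonnegative combination of the two.\<close>

lemma act_simple_nonneg:
  assumes "w \<in> carrier G" "i \<in> I" "coxeter_length w \<le> coxeter_length (w \<otimes> s i)" "k \<in> I"
  shows "0 \<le> act w (simple_root i) k"
  using assms
proof (induction "coxeter_length w" arbitrary: w i rule: less_induct)
  case less
  obtain ws where ws: "ws \<in> lists I" "word_prod ws = w" "length ws = coxeter_length w"
    using ex_reduced_word[OF less.prems(1)] by (auto simp: reduced_word_def)
  show ?case
  proof (cases ws rule: rev_exhaust)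
    case Nil
    then show ?thesis using ws by (auto simp: act_one simple_root_def)
  next
    case (snoc ws' j)
    have ws': "ws' \<in> lists I" and j: "j \<in> I" using ws snoc by auto
    have w_eq: "w = word_prod ws' \<otimes> s j" using ws snoc j ws' by (auto simp: word_prod_append)
    have len': "coxeter_length (word_prod ws') < coxeter_length w"
      using coxeter_length_le[OF ws'] ws snoc by auto
    have "w \<otimes> s j = word_prod ws'"
      unfolding w_eq using word_prod_closed[OF ws'] j by (simp add: m_assoc s_square)
    then have "i \<noteq> j" using less.prems(3) len' by auto
    \<comment> \<open>The admissible factorisations of \<open>w\<close>. The inequality keeps them
      length-additive and bounds \<open>u\<close>, so a longest \<open>u\<close> exists.\<close>
    define dec where "dec = (\<lambda>(v, u). v \<in> carrier G \<and> u \<in> lists {i, j} \<and>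
      w = v \<otimes> word_prod u \<and> coxeter_length v + length u \<le> coxeter_length w)"
    have "dec (word_prod ws', [j])" using ws' w_eq j len' by (auto simp: dec_def)
    moreover have "\<forall>y. dec y \<longrightarrow> length (snd y) < Suc (coxeter_length w)"
      by (auto simp: dec_def)
    ultimately obtain vu where vu: "dec vu" "\<And>y. dec y \<Longrightarrow> length (snd y) \<le> length (snd vu)"
      using ex_has_greatest_nat[of dec _ "\<lambda>y. length (snd y)"] by metis
    obtain v u where vu_eq: "vu = (v, u)" by force
    have v: "v \<in> carrier G" and u: "u \<in> lists {i, j}" and w_vu: "w = v \<otimes> word_prod u"
      and len: "coxeter_length v + length u \<le> coxeter_length w"
      using vu(1) by (auto simp: dec_def vu_eq)
    have ij: "{i, j} \<subseteq> I" using j less.prems by auto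
    have uI: "u \<in> lists I" using u ij by auto
    have "length u \<ge> 1" using vu(2)[OF \<open>dec (word_prod ws', [j])\<close>] by (simp add: vu_eq)
    then have len_v: "coxeter_length v < coxeter_length w" using len by simp
    \<comment> \<open>If \<open>l\<close> shortened \<open>v\<close>, it could be moved over to
      \<open>u\<close>, against maximality.\<close>
    have asc: "coxeter_length v \<le> coxeter_length (v \<otimes> s l)" if l: "l \<in> {i, j}" for l
    proof (rule ccontr)
      assume "\<not> ?thesis"
      moreover have "w = v \<otimes> s l \<otimes> word_prod (l # u)"
        using v l ij w_vu word_prod_closed[OF uI] by (auto simp: m_assoc s_cancel)
      ultimately have "dec (v \<otimes> s l, l # u)"
        using v u l ij len by (auto simp: dec_def)
      from vu(2)[OF this] show False by (simp add: vu_eq)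
    qed
    have u_alt: "u = alt i j (length u)"
    proof (rule alternating_eq_alt[OF u \<open>i \<noteq> j\<close>])
      fix us a vs
      show "u \<noteq> us @ [a, a] @ vs"
      proof
        assume eq: "u = us @ [a, a] @ vs"
        then have l: "us \<in> lists I" "vs \<in> lists I" "a \<in> I" using uI by auto
        then have "word_prod u = word_prod (us @ vs)"
          unfolding eq by (simp add: word_prod_append s_cancel)
        then have "coxeter_length w \<le> coxeter_length v + length (us @ vs)"
          using w_vu coxeter_length_mult_le[OF v, of "us @ vs"] l by simp
        then show False using len eq by simp
      qed
    next
      show "u = [] \<or> last u = j"
      proof (rule ccontr)
        assume "\<not> ?thesis"
        then have "last u = i" "u \<noteq> []" using u last_in_set[of u] by auto
        then obtain u' where eq: "u = u' @ [i]" by (metis append_butlast_last_id)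
        have u': "u' \<in> lists I" using uI eq by auto
        have "w \<otimes> s i = v \<otimes> word_prod u'"
          unfolding w_vu eq using v u' less.prems by (simp add: word_prod_append m_assoc s_square)
        then have "coxeter_length (w \<otimes> s i) \<le> coxeter_length v + length u'"
          using coxeter_length_mult_le[OF v u'] by simp
        then show False using len eq less.prems by simp
      qed
    qed
    \<comment> \<open>Otherwise the braid relation would rewrite \<open>u\<close> so that it ends in
      \<open>i\<close>, and \<open>w \<otimes> s i\<close> would be shorter than
      \<open>w\<close>.\<close>
    have "length u < m i j"
    proof (rule ccontr)
      assume "\<not> ?thesis"
      then obtain us where us: "us \<in> lists {i, j}" "u = us @ alt i j (m i j)"
        using alt_split[of "m i j" "length u" i j] u_alt by auto
      obtain n where n: "m i j = Suc n" using m_pos[of i j] less.prems j by (cases "m i j") auto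
      define vs where "vs = us @ alt i j n"
      have vsI: "vs \<in> lists I" using us ij j less.prems by (auto simp: vs_def alt_lists)
      have usI: "us \<in> lists I" using us ij by auto
      have "word_prod u = word_prod us \<otimes> word_prod (alt j i (m i j))"
        unfolding us(2) using braid_relation[of i j] less.prems j usI by (simp add: word_prod_append alt_lists del: alt.simps)
      also have "\<dots> = word_prod vs \<otimes> s i"
        unfolding n alt_Suc_snoc vs_def using less.prems j usI by (simp add: word_prod_append alt_lists m_assoc)
      finally have "w \<otimes> s i = v \<otimes> word_prod vs"
        using v vsI less.prems by (simp add: w_vu m_assoc s_square)
      then have "coxeter_length (w \<otimes> s i) \<le> coxeter_length v + length vs"
        using coxeter_length_mult_le[OF v vsI] by simp
      moreover have "length u = Suc (length vs)" using us n by (simp add: vs_def)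
      ultimately show False using len less.prems by simp
    qed
    then obtain a b where ab: "a \<ge> 0" "b \<ge> 0"
      "wact u (simple_root i) = lincomb a (simple_root i) b (simple_root j)"
      using wact_alt_nonneg[of i j "length u"] u_alt \<open>i \<noteq> j\<close> j less.prems by metis
    obtain vs where vs: "vs \<in> lists I" "word_prod vs = v" using ex_word[OF v] by metis
    have act_v: "act v = wact vs" using act_word_prod vs by blast
    have "act w (simple_root i) = act v (wact u (simple_root i))"
      unfolding w_vu using v uI by (simp add: act_mult act_word_prod)
    also have "\<dots> = lincomb a (act v (simple_root i)) b (act v (simple_root j))"
      unfolding ab(3) act_v by (rule wact_lincomb)
    finally show ?thesis
      using ab less.hyps[OF len_v v, of i] less.hyps[OF len_v v, of j] asc j less.prems
      by (simp add: lincomb_def)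
  qed
qed

section \<open>Root systems of finite Coxeter groups\<close>

text \<open>The image of the group in the linear maps of the root space. Greedy products are kept as
  such maps, so that no words have to be chosen for them.\<close>

definition weyl :: "(('i \<Rightarrow> real) \<Rightarrow> ('i \<Rightarrow> real)) set" where
  "weyl = wact ` lists I"

lemma weyl_wact: "ws \<in> lists I \<Longrightarrow> wact ws \<in> weyl"
  by (auto simp: weyl_def)

lemma weyl_id: "id \<in> weyl"
  using weyl_wact[of "[]"] by simp

lemma weyl_reflect: "i \<in> I \<Longrightarrow> reflect i \<in> weyl"
  using weyl_wact[of "[i]"] by simp

lemma weyl_comp: "f \<in> weyl \<Longrightarrow> g \<in> weyl \<Longrightarrow> f \<circ> g \<in> weyl"
proof -
  assume "f \<in> weyl" "g \<in> weyl"
  then obtain us vs where "us \<in> lists I" "f = wact us" "vs \<in> lists I" "g = wact vs"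
    by (auto simp: weyl_def)
  moreover from this have "f \<circ> g = wact (us @ vs)" by auto
  ultimately show ?thesis using weyl_wact[of "us @ vs"] by simp
qed

lemma weyl_act: "w \<in> carrier G \<Longrightarrow> act w \<in> weyl"
  by (metis act_word_prod ex_word weyl_wact)

lemma weyl_inverse:
  assumes "f \<in> weyl"
  obtains g where "g \<in> weyl" "\<And>\<beta>. f (g \<beta>) = \<beta>" "\<And>\<beta>. g (f \<beta>) = \<beta>"
proof -
  obtain ws where ws: "ws \<in> lists I" "f = wact ws" using assms by (auto simp: weyl_def)
  then have "rev ws \<in> lists I" by auto
  then show thesis using that[of "wact (rev ws)"] ws wact_rev wact_rev' weyl_wact by blast
qed

lemma weyl_lincomb: "f \<in> weyl \<Longrightarrow> f (lincomb a \<beta> b \<gamma>) = lincomb a (f \<beta>) b (f \<gamma>)"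
  by (auto simp: weyl_def wact_lincomb)

lemma weyl_minus: "f \<in> weyl \<Longrightarrow> f (- \<beta>) = - f \<beta>"
  by (auto simp: weyl_def wact_minus)

lemma weyl_B: "f \<in> weyl \<Longrightarrow> B (f \<beta>) (f \<gamma>) = B \<beta> \<gamma>"
  unfolding weyl_def using B_wact by blast

lemma weyl_refl_root: "f \<in> weyl \<Longrightarrow> f (refl_root \<beta> \<gamma>) = refl_root (f \<beta>) (f \<gamma>)"
  by (simp add: refl_root_def weyl_lincomb weyl_B)

lemma minus_minus_root [simp]: "- (- \<beta>) = (\<beta> :: 'i \<Rightarrow> real)"
  by (simp add: fun_eq_iff)

lemma mem_roots_iff: "\<beta> \<in> roots \<longleftrightarrow> (\<exists>f\<in>weyl. \<exists>i\<in>I. \<beta> = f (simple_root i))"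
proof
  assume "\<beta> \<in> roots"
  then show "\<exists>f\<in>weyl. \<exists>i\<in>I. \<beta> = f (simple_root i)" unfolding roots_def using weyl_act by blast
next
  assume "\<exists>f\<in>weyl. \<exists>i\<in>I. \<beta> = f (simple_root i)"
  then obtain ws i where "ws \<in> lists I" "i \<in> I" "\<beta> = wact ws (simple_root i)" by (auto simp: weyl_def)
  then have "\<beta> = act (word_prod ws) (simple_root i)" "word_prod ws \<in> carrier G"
    by (simp_all add: act_word_prod)
  with \<open>i \<in> I\<close> show "\<beta> \<in> roots" unfolding roots_def by blast
qed

lemma weyl_roots:
  assumes "f \<in> weyl" "\<beta> \<in> roots" shows "f \<beta> \<in> roots"
proof -
  obtain g i where g: "g \<in> weyl" "i \<in> I" "\<beta> = g (simple_root i)" using assms mem_roots_iff by blast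
  then have "f \<beta> = (f \<circ> g) (simple_root i)" by simp
  then show ?thesis unfolding mem_roots_iff using weyl_comp[OF assms(1) g(1)] g(2) by blast
qed

lemma weyl_roots_iff:
  assumes "f \<in> weyl" shows "f \<beta> \<in> roots \<longleftrightarrow> \<beta> \<in> roots"
proof -
  obtain g where g: "g \<in> weyl" "\<And>\<beta>. g (f \<beta>) = \<beta>" using weyl_inverse[OF assms] by metis
  then show ?thesis using weyl_roots[OF assms] weyl_roots[OF g(1), of "f \<beta>"] by auto
qed

lemma simple_root_in_roots: "i \<in> I \<Longrightarrow> simple_root i \<in> roots"
  unfolding mem_roots_iff using weyl_id by (metis id_apply)

lemma minus_roots:
  assumes "\<beta> \<in> roots" shows "- \<beta> \<in> roots"
proof -
  obtain f i where f: "f \<in> weyl" "i \<in> I" "\<beta> = f (simple_root i)" using assms mem_roots_iff by blast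
  then have "- \<beta> = (f \<circ> reflect i) (simple_root i)" by (simp add: reflect_simple weyl_minus[OF f(1)])
  then show ?thesis
    unfolding mem_roots_iff using weyl_comp[OF f(1) weyl_reflect[OF f(2)]] f(2) by blast
qed

lemma B_root: "\<beta> \<in> roots \<Longrightarrow> B \<beta> \<beta> = 1"
  unfolding mem_roots_iff using weyl_B B_simple_self by auto

lemma root_outside: "\<beta> \<in> roots \<Longrightarrow> j \<notin> I \<Longrightarrow> \<beta> j = 0"
proof -
  have "wact ws \<gamma> j = \<gamma> j" if "ws \<in> lists I" "j \<notin> I" for ws \<gamma>
    using that by (induction ws) (auto simp: reflect_def simple_root_def)
  moreover assume "\<beta> \<in> roots" "j \<notin> I"
  moreover from this obtain ws i where "ws \<in> lists I" "i \<in> I" "\<beta> = wact ws (simple_root i)"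
    unfolding mem_roots_iff weyl_def by blast
  ultimately have "\<beta> j = simple_root i j" by blast
  then show "\<beta> j = 0" using \<open>i \<in> I\<close> \<open>j \<notin> I\<close> by (auto simp: simple_root_def)
qed

text \<open>The reflection in \<open>f (simple_root i)\<close> is the conjugate of
  \<open>reflect i\<close> by \<open>f\<close>.\<close>

lemma weyl_refl_root_mem: 
  assumes "\<beta> \<in> roots" shows "refl_root \<beta> \<in> weyl"
proof -
  obtain f i where f: "f \<in> weyl" "i \<in> I" "\<beta> = f (simple_root i)" using assms mem_roots_iff by blast
  obtain g where g: "g \<in> weyl" "\<And>\<beta>. f (g \<beta>) = \<beta>" using weyl_inverse f(1) by metis
  have "refl_root \<beta> = f \<circ> (reflect i \<circ> g)"
    by (rule ext) (simp add: reflect_refl_root weyl_refl_root[OF f(1)] g(2) f(3)[symmetric])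
  then show ?thesis using f g weyl_comp weyl_reflect by simp
qed

text \<open>If \<beta> is the image of \<open>simple_root i\<close> under \<open>w\<close>, then one
  of \<open>w\<close> and \<open>w \<otimes> s i\<close> meets the length condition of
  \<open>act_simple_nonneg\<close>, and the second one yields -\<beta>. Both signs together would
  make \<beta> vanish, although its norm is 1.\<close>

lemma positive_root_iff: "\<beta> \<in> roots \<Longrightarrow> \<beta> \<notin> positive_roots \<longleftrightarrow> - \<beta> \<in> positive_roots"
proof -
  assume \<beta>: "\<beta> \<in> roots"
  obtain w i where w: "w \<in> carrier G" "i \<in> I" "\<beta> = act w (simple_root i)"
    using \<beta> unfolding roots_def by blast
  have eq: "act (w \<otimes> s i) (simple_root i) = - \<beta>"
    using w by (simp add: act_mult act_s reflect_simple weyl_minus[OF weyl_act])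
  have "\<beta> \<in> positive_roots \<or> - \<beta> \<in> positive_roots"
  proof (cases "coxeter_length w \<le> coxeter_length (w \<otimes> s i)")
    case True
    then show ?thesis using act_simple_nonneg[OF w(1,2)] \<beta> w(3) by (auto simp: positive_roots_def)
  next
    case False
    have "w \<otimes> s i \<otimes> s i = w" using w by (simp add: m_assoc s_square)
    then have "0 \<le> (- \<beta>) k" if "k \<in> I" for k
      using act_simple_nonneg[of "w \<otimes> s i" i k] w False that unfolding eq by auto
    then show ?thesis using minus_roots[OF \<beta>] by (auto simp: positive_roots_def)
  qed
  moreover have "\<not> (\<beta> \<in> positive_roots \<and> - \<beta> \<in> positive_roots)"
  proof
    assume "\<beta> \<in> positive_roots \<and> - \<beta> \<in> positive_roots"
    then have "\<forall>i\<in>I. \<beta> i = 0" by (fastforce simp: positive_roots_def)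
    then have "B \<beta> \<beta> = 0" by (simp add: B_gram)
    then show False using B_root[OF \<beta>] by simp
  qed
  ultimately show ?thesis by blast
qed

lemma positive_rootsD: "\<beta> \<in> positive_roots \<Longrightarrow> \<beta> \<in> roots"
  by (simp add: positive_roots_def)

lemma simple_positive: "i \<in> I \<Longrightarrow> simple_root i \<in> positive_roots"
  by (simp add: positive_roots_def simple_root_in_roots) (simp add: simple_root_def)

lemma minus_positive: "\<beta> \<in> positive_roots \<Longrightarrow> - \<beta> \<notin> positive_roots"
  using positive_root_iff positive_rootsD by blast

lemma positive_lincomb:
  "\<beta> \<in> positive_roots \<Longrightarrow> \<gamma> \<in> positive_roots \<Longrightarrow> a \<ge> 0 \<Longrightarrow> b \<ge> 0 \<Longrightarrow> lincomb a \<beta> b \<gamma> \<in> roots \<Longrightarrow>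
   lincomb a \<beta> b \<gamma> \<in> positive_roots"
  by (simp add: positive_roots_def lincomb_def)

lemma positive_eq_simple:
  assumes "\<beta> \<in> positive_roots" "i \<in> I" "\<And>j. j \<in> I \<Longrightarrow> j \<noteq> i \<Longrightarrow> \<beta> j = 0"
  shows "\<beta> = simple_root i"
proof -
  have eq: "\<beta> = lincomb (\<beta> i) (simple_root i) 0 (simple_root i)"
    using assms root_outside[OF positive_rootsD[OF assms(1)]]
    by (auto simp: fun_eq_iff lincomb_def simple_root_def)
  have "B \<beta> \<beta> = \<beta> i * \<beta> i"
    by (subst (1 2) eq) (simp add: B_lincomb_left B_lincomb_right B_simple_self assms)
  then have "(\<beta> i)\<^sup>2 = 1" using B_root[OF positive_rootsD[OF assms(1)]] by (simp add: power2_eq_square)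
  moreover have "\<beta> i \<ge> 0" using assms by (simp add: positive_roots_def)
  ultimately have "\<beta> i = 1" by (simp add: power2_eq_1_iff)
  then show ?thesis using eq by (simp add: lincomb_def)
qed

text \<open>The reflection changes only the coordinate \<open>i\<close>, so a positive coordinate
  elsewhere survives and decides the sign of the root.\<close>

lemma reflect_positive:
  assumes "\<beta> \<in> positive_roots" "i \<in> I" "\<beta> \<noteq> simple_root i"
  shows "reflect i \<beta> \<in> positive_roots"
proof (rule ccontr)
  have r: "reflect i \<beta> \<in> roots" using assms weyl_roots weyl_reflect positive_rootsD by blast
  assume "reflect i \<beta> \<notin> positive_roots"
  then have neg: "- reflect i \<beta> \<in> positive_roots" using positive_root_iff r by blast
  obtain j where j: "j \<in> I" "j \<noteq> i" "\<beta> j \<noteq> 0"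
    using positive_eq_simple assms by blast
  then have "\<beta> j > 0" using assms(1) by (auto simp: positive_roots_def less_le)
  moreover have "reflect i \<beta> j = \<beta> j" using j by (simp add: reflect_def simple_root_def)
  ultimately show False using neg j by (force simp: positive_roots_def)
qed

text \<open>Binary linearity is extended to the whole basis by adding one coordinate at a time to a
  truncated vector.\<close>

lemma weyl_expand:
  assumes "f \<in> weyl" "\<And>j. j \<notin> I \<Longrightarrow> \<beta> j = 0"
  shows "f \<beta> k = (\<Sum>i\<in>I. \<beta> i * f (simple_root i) k)"
proof -
  have "f (\<lambda>k. if k \<in> J then \<beta> k else 0) = (\<lambda>k. \<Sum>i\<in>J. \<beta> i * f (simple_root i) k)" if "finite J" for J
    using that
  proof (induction J)
    case empty
    have "(\<lambda>k. 0) = lincomb 0 (\<lambda>k. 0) 0 (\<lambda>k. 0)" by (simp add: lincomb_def)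
    then have "f (\<lambda>k. 0) = lincomb 0 (f (\<lambda>k. 0)) 0 (f (\<lambda>k. 0))" by (metis weyl_lincomb assms(1))
    then show ?case by (simp add: lincomb_def)
  next
    case (insert j J)
    have "(\<lambda>k. if k \<in> insert j J then \<beta> k else 0) =
      lincomb 1 (\<lambda>k. if k \<in> J then \<beta> k else 0) (\<beta> j) (simple_root j)"
      using insert by (auto simp: fun_eq_iff lincomb_def simple_root_def)
    then have "f (\<lambda>k. if k \<in> insert j J then \<beta> k else 0) =
      lincomb 1 (f (\<lambda>k. if k \<in> J then \<beta> k else 0)) (\<beta> j) (f (simple_root j))"
      by (simp only: weyl_lincomb[OF assms(1)])
    then show ?case unfolding insert.IH using insert.hyps by (simp add: lincomb_def add.commute)
  qed
  from this[OF finite_I] have "f (\<lambda>k. if k \<in> I then \<beta> k else 0) k = (\<Sum>i\<in>I. \<beta> i * f (simple_root i) k)"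
    by simp
  moreover have "(\<lambda>k. if k \<in> I then \<beta> k else 0) = \<beta>" using assms(2) by (auto simp: fun_eq_iff)
  ultimately show ?thesis by simp
qed

lemma weyl_expand_root:
  "f \<in> weyl \<Longrightarrow> \<beta> \<in> roots \<Longrightarrow> f \<beta> k = (\<Sum>i\<in>I. \<beta> i * f (simple_root i) k)"
  using weyl_expand root_outside by blast

section \<open>Maps that negate all positive roots, and the long element\<close>

definition negating :: "(('i \<Rightarrow> real) \<Rightarrow> ('i \<Rightarrow> real)) \<Rightarrow> bool" where
  "negating f \<longleftrightarrow> f \<in> weyl \<and> (\<forall>i\<in>I. f (simple_root i) \<notin> positive_roots)"

lemma negating_positive:
  assumes "negating f" "\<beta> \<in> positive_roots"
  shows "f \<beta> \<notin> positive_roots"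
proof -
  have f: "f \<in> weyl" using assms by (simp add: negating_def)
  have \<beta>: "\<beta> \<in> roots" using assms positive_rootsD by blast
  have neg: "f (simple_root i) k \<le> 0" if "i \<in> I" "k \<in> I" for i k
  proof -
    have "- f (simple_root i) \<in> positive_roots"
      using positive_root_iff[OF weyl_roots[OF f simple_root_in_roots[OF that(1)]]] assms(1) that
      by (simp add: negating_def)
    then have "0 \<le> (- f (simple_root i)) k" using that(2) unfolding positive_roots_def by blast
    then show ?thesis by simp
  qed
  have "f \<beta> k \<le> 0" if "k \<in> I" for k
    unfolding weyl_expand_root[OF f \<beta>, of k] using assms(2) neg that
    by (intro sum_nonpos mult_nonneg_nonpos) (simp_all add: positive_roots_def)
  then have "- f \<beta> \<in> positive_roots"
    using minus_roots[OF weyl_roots[OF f \<beta>]] by (simp add: positive_roots_def)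
  then show ?thesis using positive_root_iff[OF weyl_roots[OF f \<beta>]] by blast
qed

text \<open>Applying the inverse of \<open>f\<close> to the expansion of
  \<open>- f (simple_root i)\<close> writes \<open>simple_root i\<close> as a nonnegative
  combination of positive roots \<gamma>. A simple root is extremal, so every \<gamma> with a
  positive coefficient equals it.\<close>

lemma negating_simple:
  assumes "negating f" "i \<in> I"
  obtains j where "j \<in> I" "f (simple_root i) = - simple_root j"
proof -
  have f: "f \<in> weyl" using assms by (simp add: negating_def)
  obtain g where g: "g \<in> weyl" "\<And>\<beta>. f (g \<beta>) = \<beta>" "\<And>\<beta>. g (f \<beta>) = \<beta>" using weyl_inverse f by metis
  define \<gamma> where "\<gamma> k = - g (simple_root k)" for k
  have \<gamma>: "\<gamma> k \<in> positive_roots" if "k \<in> I" for k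
  proof -
    have "g (simple_root k) \<notin> positive_roots"
      using negating_positive[OF assms(1), of "g (simple_root k)"] g(2) simple_positive[OF that] by auto
    then show ?thesis
      unfolding \<gamma>_def using positive_root_iff[OF weyl_roots[OF g(1) simple_root_in_roots[OF that]]] by blast
  qed
  define \<beta> where "\<beta> = - f (simple_root i)"
  have \<beta>: "\<beta> \<in> positive_roots"
    unfolding \<beta>_def using assms positive_root_iff[OF weyl_roots[OF f simple_root_in_roots[OF assms(2)]]]
    by (simp add: negating_def)
  have "\<exists>j\<in>I. \<beta> j \<noteq> 0"
  proof (rule ccontr)
    assume "\<not> ?thesis"
    then have "B \<beta> \<beta> = 0" by (simp add: B_gram)
    then show False using B_root[OF positive_rootsD[OF \<beta>]] by simp
  qed
  then obtain j where j: "j \<in> I" "\<beta> j \<noteq> 0" by blast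
  then have "\<beta> j > 0" using \<beta> by (auto simp: positive_roots_def less_le)
  have "g \<beta> = - simple_root i" using g weyl_minus[OF g(1)] by (simp add: \<beta>_def)
  then have g_sum: "- simple_root i l = (\<Sum>k\<in>I. \<beta> k * g (simple_root k) l)" for l
    using weyl_expand_root[OF g(1) positive_rootsD[OF \<beta>], of l] by simp
  have sum: "simple_root i l = (\<Sum>k\<in>I. \<beta> k * \<gamma> k l)" for l
  proof -
    have "(\<Sum>k\<in>I. \<beta> k * \<gamma> k l) = - (\<Sum>k\<in>I. \<beta> k * g (simple_root k) l)"
      by (simp add: \<gamma>_def sum_negf)
    also have "\<dots> = simple_root i l" by (simp add: g_sum[symmetric])
    finally show ?thesis ..
  qed
  have "\<gamma> j = simple_root i"
  proof (rule positive_eq_simple[OF \<gamma>[OF j(1)] assms(2)])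
    fix l assume l: "l \<in> I" "l \<noteq> i"
    then have "(\<Sum>k\<in>I. \<beta> k * \<gamma> k l) = 0" using sum[of l] by (simp add: simple_root_def)
    moreover have nonneg: "0 \<le> \<beta> k * \<gamma> k l" if "k \<in> I" for k
      using \<beta> \<gamma>[OF that] that l(1) unfolding positive_roots_def by (intro mult_nonneg_nonneg) blast+
    ultimately have "\<beta> j * \<gamma> j l = 0"
      using sum_nonneg_eq_0_iff[OF finite_I nonneg] j(1) by simp
    then show "\<gamma> j l = 0" using \<open>\<beta> j > 0\<close> by simp
  qed
  then have "f (\<gamma> j) = f (simple_root i)" by simp
  then have "- simple_root j = f (simple_root i)" unfolding \<gamma>_def weyl_minus[OF f] g(2) .
  then show thesis using that j by metis
qed

lemma act_positive:
  assumes "w \<in> carrier G" "i \<in> I" "coxeter_length w \<le> coxeter_length (w \<otimes> s i)"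
  shows "act w (simple_root i) \<in> positive_roots"
  using act_simple_nonneg[OF assms] weyl_roots[OF weyl_act[OF assms(1)] simple_root_in_roots[OF assms(2)]]
  by (simp add: positive_roots_def)

text \<open>The length cannot drop along a reduced word, since the remaining letters could not make
  up for the loss.\<close>

lemma reduced_word_prefix_positive:
  assumes "reduced_word (us @ i # vs) w"
  shows "wact us (simple_root i) \<in> positive_roots"
proof -
  have l: "us \<in> lists I" "i \<in> I" "vs \<in> lists I" using assms by (auto simp: reduced_word_def)
  have w: "w = word_prod us \<otimes> s i \<otimes> word_prod vs" and len: "coxeter_length w = length us + 1 + length vs"
    using assms l by (auto simp: reduced_word_def word_prod_append m_assoc)
  have "coxeter_length w \<le> coxeter_length (word_prod us \<otimes> s i) + length vs"
    unfolding w using l by (intro coxeter_length_mult_le) auto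
  then have "coxeter_length (word_prod us) \<le> coxeter_length (word_prod us \<otimes> s i)"
    using len coxeter_length_le[OF l(1)] by simp
  then show ?thesis using act_positive[of "word_prod us" i] l by (simp add: act_word_prod)
qed

text \<open>A nonempty reduced word sends the simple root of its last letter to a negative
  root.\<close>

lemma act_simple_positive_imp_one:
  assumes "v \<in> carrier G" "\<And>i. i \<in> I \<Longrightarrow> act v (simple_root i) \<in> positive_roots"
  shows "v = \<one>"
proof -
  obtain ws where ws: "reduced_word ws v" using ex_reduced_word assms(1) by blast
  show ?thesis
  proof (cases ws rule: rev_exhaust)
    case Nil
    then show ?thesis using ws by (simp add: reduced_word_def)
  next
    case (snoc us i)
    then have l: "us \<in> lists I" "i \<in> I" and v: "v = word_prod (us @ [i])" using ws by (auto simp: reduced_word_def)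
    have "wact us (simple_root i) \<in> positive_roots"
      using reduced_word_prefix_positive[of us i "[]" v] ws snoc by simp
    moreover have "act v (simple_root i) = - wact us (simple_root i)"
      unfolding v using l by (subst act_word_prod) (auto simp: reflect_simple wact_minus)
    ultimately show ?thesis using assms(2)[OF l(2)] minus_positive by auto
  qed
qed

text \<open>A longest element negates every simple root because no letter lengthens it. If
  \<open>v\<close> and \<open>w\<close> are both longest, then \<open>inv v \<otimes> w\<close>
  keeps the simple roots positive and is trivial; this uniqueness is what the definite description
  requires.\<close>

lemma long_element:
  shows long_element_closed: "long_element \<in> carrier G"
    and negating_long_element: "negating (act long_element)"
proof -
  define longest where "longest w \<longleftrightarrow> w \<in> carrier G \<and> (\<forall>v\<in>carrier G. coxeter_length v \<le> coxeter_length w)" for w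
  have neg: "negating (act w)" if "longest w" for w
    unfolding negating_def
  proof (intro conjI ballI)
    have w: "w \<in> carrier G" using that by (simp add: longest_def)
    then show "act w \<in> weyl" by (rule weyl_act)
    fix i assume i: "i \<in> I"
    have eq: "w \<otimes> s i \<otimes> s i = w" using w i by (simp add: m_assoc s_square)
    have "act (w \<otimes> s i) (simple_root i) \<in> positive_roots"
      using that w i eq by (intro act_positive) (auto simp: longest_def)
    moreover have "act (w \<otimes> s i) (simple_root i) = - act w (simple_root i)"
      using w i by (simp add: act_mult act_s reflect_simple weyl_minus[OF weyl_act])
    ultimately show "act w (simple_root i) \<notin> positive_roots" using minus_positive by force
  qed
  have ex: "\<exists>w. longest w"
  proof -
    have "Max (coxeter_length ` carrier G) \<in> coxeter_length ` carrier G"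
      using finite_carrier by (intro Max_in) auto
    then obtain w where "w \<in> carrier G" "coxeter_length w = Max (coxeter_length ` carrier G)" by auto
    then have "longest w" using finite_carrier by (simp add: longest_def)
    then show ?thesis ..
  qed
  have uniq: "v = w" if "longest v" "longest w" for v w
  proof -
    have vw: "v \<in> carrier G" "w \<in> carrier G" using that by (auto simp: longest_def)
    have "inv v \<otimes> w = \<one>"
    proof (rule act_simple_positive_imp_one)
      fix i assume i: "i \<in> I"
      define \<gamma> where "\<gamma> = act (inv v \<otimes> w) (simple_root i)"
      have \<gamma>: "\<gamma> \<in> roots" unfolding \<gamma>_def using vw i by (intro weyl_roots[OF weyl_act simple_root_in_roots]) auto
      have "act v (- \<gamma>) = - act w (simple_root i)"
        using vw by (simp add: weyl_minus[OF weyl_act] \<gamma>_def act_mult act_act_inv)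
      moreover have "- act w (simple_root i) \<in> positive_roots"
        using neg[OF that(2)] i positive_root_iff[OF weyl_roots[OF weyl_act[OF vw(2)] simple_root_in_roots[OF i]]]
        by (simp add: negating_def)
      ultimately have "- \<gamma> \<notin> positive_roots" using negating_positive[OF neg[OF that(1)], of "- \<gamma>"] by auto
      then show "act (inv v \<otimes> w) (simple_root i) \<in> positive_roots"
        using positive_root_iff[OF \<gamma>] by (simp add: \<gamma>_def)
    qed (use vw in auto)
    then show ?thesis using vw by (metis inv_equality inv_inv inv_closed)
  qed
  have "longest (THE w. longest w)" using ex uniq by (metis the_equality)
  then have "longest long_element" by (simp add: long_element_def longest_def)
  then show "long_element \<in> carrier G" "negating (act long_element)" using neg by (auto simp: longest_def)
qed

section \<open>Greedy words\<close>

text \<open>One step of the Demazure product: positivity of the image of the simple root means that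
  right multiplication by the reflection increases the length.\<close>

definition up :: "(('i \<Rightarrow> real) \<Rightarrow> ('i \<Rightarrow> real)) \<Rightarrow> 'i \<Rightarrow> (('i \<Rightarrow> real) \<Rightarrow> ('i \<Rightarrow> real))" where
  "up f i = (if f (simple_root i) \<in> positive_roots then f \<circ> reflect i else f)"

text \<open>The periodic word with period \<open>xs\<close>, in the order in which the letters are
  applied; hence \<open>xs\<close> will be the reverse of the list given to
  \<open>Pro\<close>.\<close>

definition letter :: "'i list \<Rightarrow> nat \<Rightarrow> 'i" where
  "letter xs t = hd (rotate t xs)"

primrec greedy :: "'i list \<Rightarrow> nat \<Rightarrow> (('i \<Rightarrow> real) \<Rightarrow> ('i \<Rightarrow> real))" where
  "greedy xs 0 = id"
| "greedy xs (Suc t) = up (greedy xs t) (letter xs t)"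

definition used :: "'i list \<Rightarrow> nat \<Rightarrow> bool" where
  "used xs t \<longleftrightarrow> greedy xs t (simple_root (letter xs t)) \<in> positive_roots"

definition ordering :: "'i list \<Rightarrow> bool" where
  "ordering xs \<longleftrightarrow> distinct xs \<and> set xs = I \<and> xs \<noteq> []"

lemma greedy_used: "used xs t \<Longrightarrow> greedy xs (Suc t) = greedy xs t \<circ> reflect (letter xs t)"
  by (simp add: used_def up_def)

lemma greedy_skip: "\<not> used xs t \<Longrightarrow> greedy xs (Suc t) = greedy xs t"
  by (simp add: used_def up_def)

lemma letter_mem: "ordering xs \<Longrightarrow> letter xs t \<in> I"
  unfolding letter_def ordering_def by (metis hd_in_set rotate_is_Nil_conv set_rotate)

lemma letter_rotate1: "letter (rotate1 xs) t = letter xs (Suc t)"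
  by (simp add: letter_def rotate1_rotate_swap)

lemma ordering_rotate1: "ordering xs \<Longrightarrow> ordering (rotate1 xs)"
  by (simp add: ordering_def)

lemma rotate_Cons:
  assumes "ordering xs"
  obtains ys where "rotate t xs = letter xs t # ys" "rotate (Suc t) xs = ys @ [letter xs t]"
    "distinct (letter xs t # ys)" "I = set (letter xs t # ys)"
proof -
  have "rotate t xs \<noteq> []" using assms by (simp add: ordering_def)
  then have eq: "rotate t xs = letter xs t # tl (rotate t xs)" by (simp add: letter_def)
  moreover have "rotate (Suc t) xs = tl (rotate t xs) @ [letter xs t]"
    using eq by (metis rotate1.simps(2) rotate_Suc)
  moreover have "distinct (rotate t xs)" "set (rotate t xs) = I" using assms by (simp_all add: ordering_def)
  ultimately show thesis using that[of "tl (rotate t xs)"] by metis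
qed

lemma up_weyl: "f \<in> weyl \<Longrightarrow> i \<in> I \<Longrightarrow> up f i \<in> weyl"
  by (simp add: up_def weyl_comp weyl_reflect)

lemma greedy_weyl: "ordering xs \<Longrightarrow> greedy xs t \<in> weyl"
  by (induction t) (simp_all add: weyl_id up_weyl letter_mem)

text \<open>
  The greedy products of a word and of the word without its first letter \<open>i\<close> differ by the factor \<open>i\<close> on
  the left until the shorter word uses a letter whose simple root it sends to that of \<open>i\<close>; the longer word
  skips this letter, and from then on the two products agree.
\<close>

definition shifted :: "'i \<Rightarrow> (('i \<Rightarrow> real) \<Rightarrow> ('i \<Rightarrow> real)) \<Rightarrow> (('i \<Rightarrow> real) \<Rightarrow> ('i \<Rightarrow> real)) \<Rightarrow> bool" where
  "shifted i d d' \<longleftrightarrow> d = d' \<or>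
    d = reflect i \<circ> d' \<and> (\<exists>\<gamma>\<in>positive_roots. d' \<gamma> = simple_root i)"

text \<open>The reflection in \<open>simple_root i\<close> changes the sign of a root only if the
  root is plus or minus \<open>simple_root i\<close>. So both products treat \<open>j\<close> alike,
  except when \<open>d'\<close> sends the root of \<open>j\<close> to that of \<open>i\<close>,
  where they merge.\<close>

lemma shifted_up:
  assumes d': "d' \<in> weyl" and ij: "i \<in> I" "j \<in> I" and sh: "shifted i d d'"
  shows "shifted i (up d j) (up d' j) \<and>
    (d (simple_root j) \<in> positive_roots \<longrightarrow> d' (simple_root j) \<in> positive_roots) \<and>
    (d (simple_root j) \<notin> positive_roots \<longrightarrow> d' (simple_root j) \<in> positive_roots \<longrightarrow>
      d (simple_root j) = - simple_root i)"
proof (cases "d = d'")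
  case True
  then show ?thesis by (simp add: shifted_def)
next
  case False
  then obtain \<gamma> where d: "d = reflect i \<circ> d'" and \<gamma>: "\<gamma> \<in> positive_roots" "d' \<gamma> = simple_root i"
    using sh by (auto simp: shifted_def)
  define \<delta> where "\<delta> = d' (simple_root j)"
  have dj: "d (simple_root j) = reflect i \<delta>" by (simp add: d \<delta>_def)
  have \<delta>: "\<delta> \<in> roots" unfolding \<delta>_def using d' ij weyl_roots simple_root_in_roots by blast
  obtain g where g: "g \<in> weyl" "\<And>\<beta>. g (d' \<beta>) = \<beta>" using weyl_inverse[OF d'] by metis
  consider "\<delta> = simple_root i" | "\<delta> \<in> positive_roots" "\<delta> \<noteq> simple_root i" | "\<delta> \<notin> positive_roots"
    by blast
  then show ?thesis
  proof cases
    case 1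
    \<comment> \<open>Since \<open>d'\<close> sends one simple root to the other, it conjugates one
      reflection to the other.\<close>
    have "d' (reflect j \<beta>) = reflect i (d' \<beta>)" for \<beta>
      unfolding reflect_refl_root weyl_refl_root[OF d'] using 1 by (simp add: \<delta>_def)
    then have comm: "d' \<circ> reflect j = d" unfolding d by (intro ext) simp
    have neg: "d (simple_root j) = - simple_root i" using dj 1 reflect_simple ij by simp
    have notpos: "d (simple_root j) \<notin> positive_roots"
      unfolding neg using minus_positive simple_positive ij by blast
    have "d' (simple_root j) \<in> positive_roots"
      using 1 simple_positive ij by (simp add: \<delta>_def)
    then have "up d j = d" "up d' j = d" using notpos comm by (simp_all add: up_def)
    then have "shifted i (up d j) (up d' j)" by (simp add: shifted_def)
    then show ?thesis using neg notpos by blast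
  next
    case 2
    then have pos: "d (simple_root j) \<in> positive_roots" "d' (simple_root j) \<in> positive_roots"
      unfolding dj using reflect_positive ij by (auto simp: \<delta>_def)
    have "\<gamma> \<noteq> simple_root j" using 2 \<gamma> by (auto simp: \<delta>_def)
    then have "reflect j \<gamma> \<in> positive_roots" using reflect_positive \<gamma> ij by blast
    moreover have "(d' \<circ> reflect j) (reflect j \<gamma>) = simple_root i" using \<gamma> ij by (simp add: reflect_reflect)
    moreover have "up d j = reflect i \<circ> up d' j" "up d' j = d' \<circ> reflect j"
      using pos d by (simp_all add: up_def comp_assoc)
    ultimately have "shifted i (up d j) (up d' j)" unfolding shifted_def by metis
    then show ?thesis using pos by blast
  next
    case 3
    have "- \<delta> \<in> positive_roots" using 3 positive_root_iff \<delta> by blast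
    \<comment> \<open>The preimage of \<open>simple_root i\<close> under \<open>d'\<close> is the
      positive root \<gamma>, not the negative of a simple root.\<close>
    moreover have "- \<delta> \<noteq> simple_root i"
    proof
      assume "- \<delta> = simple_root i"
      then have "d' (- simple_root j) = d' \<gamma>" using \<gamma> by (simp add: \<delta>_def weyl_minus[OF d'])
      then have "- simple_root j = \<gamma>" using g(2) by metis
      then show False using \<gamma> minus_positive simple_positive ij by blast
    qed
    ultimately have "reflect i (- \<delta>) \<in> positive_roots" using reflect_positive ij by blast
    then have "- reflect i \<delta> \<in> positive_roots" using weyl_minus[OF weyl_reflect[OF ij(1)]] by simp
    then have "reflect i \<delta> \<notin> positive_roots" using minus_positive by blast
    then show ?thesis using 3 sh unfolding up_def dj \<delta>_def by simp
  qed
qed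

text \<open>The first letter is always used and is the one that the rotation drops, hence the offset
  by one.\<close>

lemma shifted_greedy:
  assumes "ordering xs"
  shows "shifted (hd xs) (greedy xs (Suc t)) (greedy (rotate1 xs) t)"
proof (induction t)
  case 0
  have hd: "hd xs \<in> I" using letter_mem[OF assms, of 0] by (simp add: letter_def)
  then show ?case
    using simple_positive by (auto simp: up_def letter_def shifted_def)
next
  case (Suc t)
  have "hd xs \<in> I" using letter_mem[OF assms, of 0] by (simp add: letter_def)
  from shifted_up[OF greedy_weyl[OF ordering_rotate1[OF assms]] this letter_mem[OF assms] Suc]
  show ?case unfolding greedy.simps(2)[of _ "Suc t"] greedy.simps(2)[of "rotate1 xs" t] letter_rotate1 by blast
qed

text \<open>The two words decide differently only at the moment of merging, where the image of the
  skipped root is known.\<close>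

lemma
  assumes "ordering xs"
  shows used_rotate1: "used xs (Suc t) \<Longrightarrow> used (rotate1 xs) t"
    and newly_used_rotate1: "\<not> used xs (Suc t) \<Longrightarrow> used (rotate1 xs) t \<Longrightarrow>
      greedy xs (Suc t) (simple_root (letter xs (Suc t))) = - simple_root (hd xs)"
proof -
  have hd: "hd xs \<in> I" using letter_mem[OF assms, of 0] by (simp add: letter_def)
  note * = shifted_up[OF greedy_weyl[OF ordering_rotate1[OF assms], of t] hd letter_mem[OF assms, of "Suc t"]
    shifted_greedy[OF assms, of t]]
  show "used xs (Suc t) \<Longrightarrow> used (rotate1 xs) t"
    using * unfolding used_def letter_rotate1 by blast
  show "\<not> used xs (Suc t) \<Longrightarrow> used (rotate1 xs) t \<Longrightarrow>
      greedy xs (Suc t) (simple_root (letter xs (Suc t))) = - simple_root (hd xs)"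
    using * unfolding used_def letter_rotate1 by blast
qed

section \<open>The Euler form of a Coxeter element under rotation\<close>

fun precedes :: "'i list \<Rightarrow> 'i \<Rightarrow> 'i \<Rightarrow> bool" where
  "precedes [] a b \<longleftrightarrow> False"
| "precedes (x # xs) a b \<longleftrightarrow> (if x = a then b \<in> set xs else precedes xs a b)"

lemma precedes_mem: "precedes xs a b \<Longrightarrow> a \<in> set xs \<and> b \<in> set xs"
  by (induction xs) (auto split: if_splits)

lemma precedes_snoc:
  "x \<notin> set ys \<Longrightarrow> precedes (ys @ [x]) a b \<longleftrightarrow> (if b = x then a \<in> set ys else precedes ys a b)"
  by (induction ys) auto

text \<open>
  The matrix of the Euler form \<open>E\<close> of the Coxeter element with word \<open>xs\<close>, normalised by
  \<open>E(\<beta>, \<gamma>) + E(\<gamma>, \<beta>) = 2 B(\<beta>, \<gamma>)\<close>.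
\<close>

definition euler :: "'i list \<Rightarrow> 'i \<Rightarrow> 'i \<Rightarrow> real" where
  "euler xs a b = (if a = b then 1 else if precedes xs b a then 2 * gram a b else 0)"

lemma euler_self: "euler xs a a = 1"
  by (simp add: euler_def)

lemma euler_first: "distinct (x # ys) \<Longrightarrow> b \<noteq> x \<Longrightarrow> euler (x # ys) x b = 0"
  by (auto simp: euler_def dest: precedes_mem)

text \<open>The right-hand side is the old form evaluated at the images of two simple roots under
  the reflection of \<open>x\<close>. Moving \<open>x\<close> to the end reverses only the pairs
  that contain \<open>x\<close>.\<close>

lemma euler_rotate:
  assumes "distinct (x # ys)" "set (x # ys) = I" "a \<in> I" "b \<in> I"
  shows "euler (ys @ [x]) a b =
    euler (x # ys) a b - 2 * gram a x * euler (x # ys) x b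
    - 2 * gram b x * euler (x # ys) a x + 4 * gram a x * gram b x"
proof -
  have x: "x \<in> I" "x \<notin> set ys" using assms by auto
  have mem: "c \<in> set ys" if "c \<in> I" "c \<noteq> x" for c using that assms(2) by auto
  have not_prec: "\<not> precedes ys c x" "\<not> precedes ys x c" for c using precedes_mem x(2) by blast+
  show ?thesis
  proof (cases "a = x"; cases "b = x")
    assume "a = x" "b = x"
    then show ?thesis by (simp add: euler_def gram_self[OF x(1)])
  next
    assume "a = x" "b \<noteq> x"
    then show ?thesis
      using mem[OF assms(4)] x not_prec gram_sym[OF assms(4) x(1)]
      by (simp add: euler_def precedes_snoc gram_self)
  next
    assume "a \<noteq> x" "b = x"
    then show ?thesis
      using mem[OF assms(3)] x not_prec by (simp add: euler_def precedes_snoc gram_self)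
  next
    assume "a \<noteq> x" "b \<noteq> x"
    then show ?thesis
      using mem[OF assms(3)] x not_prec by (simp add: euler_def precedes_snoc)
  qed
qed

definition euler_form :: "'i list \<Rightarrow> ('i \<Rightarrow> real) \<Rightarrow> ('i \<Rightarrow> real) \<Rightarrow> real" where
  "euler_form xs \<beta> \<gamma> = (\<Sum>a\<in>I. \<Sum>b\<in>I. \<beta> a * \<gamma> b * euler xs a b)"

lemma euler_form_lincomb_left:
  "euler_form xs (lincomb a \<beta> b \<gamma>) \<delta> = a * euler_form xs \<beta> \<delta> + b * euler_form xs \<gamma> \<delta>"
  unfolding euler_form_def lincomb_def sum_distrib_left sum.distrib[symmetric]
  by (intro sum.cong[OF HOL.refl]) (simp add: algebra_simps)

lemma euler_form_lincomb_right:
  "euler_form xs \<delta> (lincomb a \<beta> b \<gamma>) = a * euler_form xs \<delta> \<beta> + b * euler_form xs \<delta> \<gamma>"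
  unfolding euler_form_def lincomb_def sum_distrib_left sum.distrib[symmetric]
  by (intro sum.cong[OF HOL.refl]) (simp add: algebra_simps)

lemma euler_form_simple_left:
  assumes "i \<in> I" shows "euler_form xs (simple_root i) \<gamma> = (\<Sum>b\<in>I. \<gamma> b * euler xs i b)"
proof -
  have "euler_form xs (simple_root i) \<gamma> = (\<Sum>a\<in>I. if a = i then (\<Sum>b\<in>I. \<gamma> b * euler xs a b) else 0)"
    unfolding euler_form_def by (intro sum.cong[OF HOL.refl]) (simp add: simple_root_def)
  then show ?thesis using assms finite_I by simp
qed

lemma euler_form_simple:
  assumes "i \<in> I" "j \<in> I" shows "euler_form xs (simple_root i) (simple_root j) = euler xs i j"
proof -
  have "euler_form xs (simple_root i) (simple_root j) = (\<Sum>b\<in>I. if b = j then euler xs i b else 0)"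
    unfolding euler_form_simple_left[OF assms(1)] by (intro sum.cong[OF HOL.refl]) (simp add: simple_root_def)
  then show ?thesis using assms finite_I by simp
qed

section \<open>Skipped letters and the letters that they block\<close>

definition alive :: "'i list \<Rightarrow> nat \<Rightarrow> 'i \<Rightarrow> bool" where
  "alive xs t a \<longleftrightarrow> (\<forall>r<t. letter xs r = a \<longrightarrow> used xs r)"

lemma alive_mono: "alive xs t a \<Longrightarrow> r \<le> t \<Longrightarrow> alive xs r a"
  by (auto simp: alive_def)

text \<open>
  Skipping a letter does not rotate the form, but this affects only the entries of the skipped letter.
\<close>

lemma euler_greedy:
  assumes "ordering xs" "\<And>r. r < t \<Longrightarrow> used xs r \<Longrightarrow> alive xs r (letter xs r)"
    "a \<in> I" "b \<in> I" "alive xs t a" "alive xs t b"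
  shows "euler_form xs (greedy xs t (simple_root a)) (greedy xs t (simple_root b)) = euler (rotate t xs) a b"
  using assms
proof (induction t arbitrary: a b)
  case 0
  then show ?case by (simp add: euler_form_simple)
next
  case (Suc t)
  define x where "x = letter xs t"
  define f where "f = greedy xs t"
  have x: "x \<in> I" using letter_mem Suc.prems(1) by (simp add: x_def)
  have f: "f \<in> weyl" using greedy_weyl Suc.prems(1) by (simp add: f_def)
  obtain ys where ys: "rotate t xs = x # ys" "rotate (Suc t) xs = ys @ [x]" "distinct (x # ys)" "I = set (x # ys)"
    using rotate_Cons[OF Suc.prems(1)] unfolding x_def by metis
  have al: "alive xs t a" "alive xs t b" using Suc.prems alive_mono by (auto intro: le_SucI)
  have IH: "euler_form xs (f (simple_root c)) (f (simple_root d)) = euler (x # ys) c d"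
    if "c \<in> I" "d \<in> I" "alive xs t c" "alive xs t d" for c d
    using Suc.IH[OF Suc.prems(1) _ that] Suc.prems(2) unfolding f_def ys(1) by simp
  note rot = euler_rotate[OF ys(3) ys(4)[symmetric] Suc.prems(3,4)]
  show ?case
  proof (cases "used xs t")
    case True
    then have alx: "alive xs t x" using Suc.prems(2) by (simp add: x_def)
    have step: "greedy xs (Suc t) (simple_root c) =
      lincomb 1 (f (simple_root c)) (- 2 * gram c x) (f (simple_root x))" if "c \<in> I" for c
      unfolding greedy_used[OF True] comp_apply x_def[symmetric] f_def[symmetric] reflect_lincomb
        weyl_lincomb[OF f] B_simple_simple[OF that x] ..
    show ?thesis
      unfolding step[OF Suc.prems(3)] step[OF Suc.prems(4)] ys(2) rot
        euler_form_lincomb_left euler_form_lincomb_right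
        IH[OF Suc.prems(3,4) al] IH[OF Suc.prems(3) x al(1) alx] IH[OF x Suc.prems(4) alx al(2)] IH[OF x x alx alx] euler_self
      by (simp add: algebra_simps)
  next
    case False
    then have "a \<noteq> x" "b \<noteq> x" using Suc.prems(5,6) by (auto simp: alive_def x_def)
    \<comment> \<open>Since \<open>x\<close> comes first, the correction terms of the rotation
      formula cancel for \<open>a\<close> and \<open>b\<close> different from
      \<open>x\<close>.\<close>
    then have "euler (x # ys) x b = 0" "euler (x # ys) a x = 2 * gram a x"
      using euler_first[OF ys(3)] Suc.prems(3) ys(4) by (auto simp: euler_def)
    then have "euler (ys @ [x]) a b = euler (x # ys) a b" using rot by simp
    then show ?thesis
      unfolding greedy_skip[OF False] f_def[symmetric] ys(2) IH[OF Suc.prems(3,4) al] by (rule HOL.sym)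
  qed
qed

text \<open>A nonzero Gram entry means that the letters are equal or do not commute. The induction
  runs over all orderings at once, because passing to the rotated word lowers \<open>t'\<close> by
  one.\<close>

lemma used_imp_used:
  assumes "ordering xs" "t < t'" "used xs t'" "gram (letter xs t) (letter xs t') \<noteq> 0"
  shows "used xs t"
  using assms
proof (induction t' arbitrary: xs t rule: less_induct)
  case (less t')
  note ord = less.prems(1)
  define j where "j = letter xs t'"
  have jI: "j \<in> I" using letter_mem[OF ord] by (simp add: j_def)
  define h where "h = hd xs"
  have hI: "h \<in> I" using letter_mem[OF ord, of 0] by (simp add: h_def letter_def)
  have w: "greedy xs r \<in> weyl" for r using greedy_weyl[OF ord] .
  have used_alive: "alive xs r (letter xs r)" if "r < t'" "used xs r" for r
    unfolding alive_def
  proof (intro allI impI)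
    fix q assume q: "q < r" "letter xs q = letter xs r"
    then have "gram (letter xs q) (letter xs r) = 1" using gram_self letter_mem[OF ord] by simp
    then show "used xs q" using less.IH[OF that(1) ord q(1) that(2)] by simp
  qed
  \<comment> \<open>The rotated word uses \<open>t'\<close>, hence by induction also this skipped
    position, so the position is newly used there. Afterwards only letters orthogonal to the skipped
    one are used before \<open>t'\<close>, which keeps the image constant.\<close>
  have neg: "greedy xs r (simple_root (letter xs q)) = - simple_root h"
    if q: "q < t'" "\<not> used xs q" "gram (letter xs q) j \<noteq> 0" and r: "q \<le> r" "r \<le> t'" for q r
    using r
  proof (induction r rule: dec_induct)
    case base
    have "q \<noteq> 0"
    proof
      assume "q = 0"
      then have "used xs q" using simple_positive letter_mem[OF ord] by (simp add: used_def)
      then show False using q by simp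
    qed
    then obtain q0 where q0: "q = Suc q0" by (cases q) auto
    obtain t0 where t0: "t' = Suc t0" using q by (cases t') auto
    have "used (rotate1 xs) t0" using used_rotate1[OF ord] less.prems(3) t0 by simp
    then have "used (rotate1 xs) q0"
      using less.IH[of t0 "rotate1 xs" q0] ordering_rotate1[OF ord] q q0 t0
      by (simp add: letter_rotate1 j_def)
    then show ?case using newly_used_rotate1[OF ord, of q0] q q0 by (simp add: h_def)
  next
    case (step r)
    have IH: "greedy xs r (simple_root (letter xs q)) = - simple_root h"
      by (rule step.IH) (use step.prems in simp)
    show ?case
    proof (cases "used xs r")
      case True
      then have "r \<noteq> q" using q(2) by blast
      then have "q < r" "r < t'" using step.hyps step.prems by simp_all
      then have "gram (letter xs q) (letter xs r) = 0"
        using less.IH[OF _ ord _ True] q(2) by blast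
      then have fixed: "reflect (letter xs r) (simple_root (letter xs q)) = simple_root (letter xs q)"
        using letter_mem[OF ord] by (simp add: reflect_lincomb B_simple_simple lincomb_def)
      show ?thesis unfolding greedy_used[OF True] comp_apply fixed by (rule IH)
    next
      case False
      show ?thesis unfolding greedy_skip[OF False] by (rule IH)
    qed
  qed
  have skip_ne: "letter xs q \<noteq> j" if "q < t'" "\<not> used xs q" "gram (letter xs q) j \<noteq> 0" for q
  proof
    assume "letter xs q = j"
    then have "greedy xs t' (simple_root j) = - simple_root h" using neg[OF that] that(1) by simp
    then have "- simple_root h \<in> positive_roots" using less.prems(3) unfolding used_def j_def by simp
    then show False using minus_positive simple_positive[OF hI] by blast
  qed
  have alive_j: "alive xs t' j"
    unfolding alive_def
  proof (intro allI impI)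
    fix r assume "r < t'" "letter xs r = j"
    then show "used xs r" using skip_ne[of r] gram_self[OF jI] by (cases "used xs r") simp_all
  qed
  show "used xs t"
  proof (rule ccontr)
    assume "\<not> used xs t"
    define i where "i = letter xs t"
    have iI: "i \<in> I" using letter_mem[OF ord] by (simp add: i_def)
    \<comment> \<open>The first skip of \<open>i\<close>: up to this time \<open>i\<close> is alive,
      so \<open>euler_greedy\<close> applies to it.\<close>
    define q where "q = (LEAST q. letter xs q = i \<and> \<not> used xs q)"
    have q: "letter xs q = i" "\<not> used xs q"
      using LeastI[of "\<lambda>q. letter xs q = i \<and> \<not> used xs q" t] \<open>\<not> used xs t\<close> by (auto simp: q_def i_def)
    have "q \<le> t" unfolding q_def using \<open>\<not> used xs t\<close> by (intro Least_le) (simp add: i_def)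
    then have qt': "q < t'" using less.prems by simp
    have gij: "gram i j \<noteq> 0" using less.prems by (simp add: i_def j_def)
    have ij: "i \<noteq> j" using skip_ne[OF qt' q(2)] q(1) gij by simp
    have alive_i: "alive xs q i"
      unfolding alive_def q_def using not_less_Least[of _ "\<lambda>q. letter xs q = i \<and> \<not> used xs q"] by blast
    have neg_i: "greedy xs r (simple_root i) = - simple_root h" if "q \<le> r" "r \<le> t'" for r
      using neg[OF qt' q(2) _ that] q(1) gij by simp
    \<comment> \<open>As \<open>h\<close> is the first letter, its row of the Euler matrix is a unit
      vector and the form reads off a coordinate.\<close>
    have form_h: "euler_form xs (simple_root h) \<gamma> = \<gamma> h" for \<gamma>
    proof -
      obtain ys where xs: "xs = h # ys" "distinct (h # ys)"
        using ord by (cases xs) (auto simp: ordering_def h_def)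
      have "(\<Sum>b\<in>I. \<gamma> b * euler xs h b) = (\<Sum>b\<in>I. if b = h then \<gamma> b else 0)"
        using euler_first[OF xs(2)] unfolding xs(1)[symmetric]
        by (intro sum.cong[OF HOL.refl]) (auto simp: euler_def)
      then show ?thesis unfolding euler_form_simple_left[OF hI] using finite_I hI by simp
    qed
    \<comment> \<open>At time \<open>q\<close> the letter \<open>i\<close> is first in the rotated
      ordering, so its Euler form with \<open>l\<close> vanishes. The vanishing persists because
      letters used later, before \<open>t'\<close>, are orthogonal to \<open>i\<close> and were
      alive at \<open>q\<close>.\<close>
    have zero: "greedy xs r (simple_root l) h = 0"
      if r: "q \<le> r" "r \<le> t'" and l: "l \<in> I" "alive xs q l" "l \<noteq> i" for r l
      using r l
    proof (induction r arbitrary: l rule: dec_induct)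
      case base
      have "euler_form xs (greedy xs q (simple_root i)) (greedy xs q (simple_root l)) = euler (rotate q xs) i l"
        using qt' base by (intro euler_greedy[OF ord] used_alive iI alive_i) auto
      also have "\<dots> = 0"
      proof -
        obtain ys where "rotate q xs = i # ys" "distinct (i # ys)"
          using rotate_Cons[OF ord, of q] q(1) by metis
        then show ?thesis using euler_first[of i ys l] base by simp
      qed
      finally have "euler_form xs (lincomb (-1) (simple_root h) 0 (simple_root h)) (greedy xs q (simple_root l)) = 0"
        using neg_i[of q] qt' by (simp add: uminus_lincomb[symmetric])
      then show ?case unfolding euler_form_lincomb_left form_h by simp
    next
      case (step r)
      show ?case
      proof (cases "used xs r")
        case True
        define y where "y = letter xs r"
        have y: "y \<in> I" using letter_mem[OF ord] by (simp add: y_def)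
        have "r \<noteq> q" using q(2) True by blast
        then have "q < r" "r < t'" using step.hyps step.prems by simp_all
        then have "gram i y = 0"
          using less.IH[OF _ ord _ True, of q] q unfolding y_def by blast
        then have "y \<noteq> i" using gram_self[OF iI] by auto
        moreover have "alive xs q y"
          using alive_mono[OF used_alive[OF \<open>r < t'\<close> True], of q] \<open>q < r\<close> by (simp add: y_def)
        ultimately have "greedy xs r (simple_root y) h = 0" "greedy xs r (simple_root l) h = 0"
          using step.IH[OF _ y] step.IH[OF _ step.prems(2-4)] step.prems(1) by simp_all
        then show ?thesis
          unfolding greedy_used[OF True] comp_apply reflect_lincomb weyl_lincomb[OF w] y_def[symmetric]
          by (simp add: lincomb_def)
      next
        case False
        then show ?thesis using step greedy_skip by simp
      qed
    qed
    define \<delta> where "\<delta> = greedy xs t' (simple_root j)"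
    have \<delta>: "\<delta> \<in> positive_roots" using less.prems(3) by (simp add: used_def \<delta>_def j_def)
    have "\<delta> h = 0"
      unfolding \<delta>_def using zero[of t' j] qt' jI alive_mono[OF alive_j] ij by simp
    have "B \<delta> (- simple_root h) = gram j i"
      using weyl_B[OF w, of t' "simple_root j" "simple_root i"] neg_i[of t'] qt' jI iI
      by (simp add: \<delta>_def B_simple_simple)
    then have "B \<delta> (simple_root h) > 0"
      using gram_nonpos[OF jI iI] gij ij gram_sym[OF iI jI] by (simp add: B_minus_right)
    moreover have "B \<delta> (simple_root h) \<le> 0"
      unfolding B_simple[OF hI]
    proof (rule sum_nonpos)
      fix k assume k: "k \<in> I"
      show "\<delta> k * gram k h \<le> 0"
      proof (cases "k = h")
        case False
        then show ?thesis
          using gram_nonpos[OF k hI] \<delta> k by (intro mult_nonneg_nonpos) (auto simp: positive_roots_def)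
      qed (simp add: \<open>\<delta> h = 0\<close>)
    qed
    ultimately show False by simp
  qed
qed

text \<open>After a skip only orthogonal letters are used, so the image of the skipped root is
  already the one at time \<open>T\<close>, where simple roots go to negatives of simple
  roots.\<close>

lemma skip_simple:
  assumes ord: "ordering xs" and neg: "negating (greedy xs T)" and t: "t < T" "\<not> used xs t"
  obtains j where "j \<in> I" "greedy xs t (simple_root (letter xs t)) = - simple_root j"
proof -
  have const: "greedy xs r (simple_root (letter xs t)) = greedy xs t (simple_root (letter xs t))" if "t \<le> r" for r
    using that
  proof (induction r rule: dec_induct)
    case (step r)
    show ?case
    proof (cases "used xs r")
      case True
      then have "t \<noteq> r" using t(2) by blast
      then have "t < r" using step.hyps by simp
      then have "gram (letter xs t) (letter xs r) = 0"
        using used_imp_used[OF ord _ True] t(2) by blast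
      then have fixed: "reflect (letter xs r) (simple_root (letter xs t)) = simple_root (letter xs t)"
        using letter_mem[OF ord] by (simp add: reflect_lincomb B_simple_simple lincomb_def)
      show ?thesis unfolding greedy_used[OF True] comp_apply fixed by (rule step.IH)
    next
      case False
      show ?thesis unfolding greedy_skip[OF False] by (rule step.IH)
    qed
  qed simp
  note eq = const[OF less_imp_le[OF t(1)]]
  obtain j where "j \<in> I" "greedy xs T (simple_root (letter xs t)) = - simple_root j"
    by (rule negating_simple[OF neg letter_mem[OF ord, of t]])
  then show thesis using that eq by simp
qed

section \<open>Bruhat order\<close>

lemma subseq_lists: "subseq xs ys \<Longrightarrow> ys \<in> lists A \<Longrightarrow> xs \<in> lists A"
  by (induction rule: list_emb.induct) auto

lemma subseq_rev: "subseq xs ys \<Longrightarrow> subseq (rev xs) (rev ys)"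
  by (induction rule: list_emb.induct) (auto intro: list_emb_append_mono)

text \<open>Right multiplication by a reflection that increases the length; the reflexive transitive
  closure is the strong Bruhat order.\<close>

definition bruhat_step :: "(('i \<Rightarrow> real) \<Rightarrow> ('i \<Rightarrow> real)) \<Rightarrow> (('i \<Rightarrow> real) \<Rightarrow> ('i \<Rightarrow> real)) \<Rightarrow> bool" where
  "bruhat_step f g \<longleftrightarrow> f \<in> weyl \<and> (\<exists>\<beta>\<in>positive_roots. f \<beta> \<in> positive_roots \<and> g = f \<circ> refl_root \<beta>)"

abbreviation bruhat_le where "bruhat_le \<equiv> bruhat_step\<^sup>*\<^sup>*"

lemma bruhat_step_weyl: "bruhat_step f g \<Longrightarrow> g \<in> weyl"
  unfolding bruhat_step_def using weyl_comp weyl_refl_root_mem positive_rootsD by blast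

lemma bruhat_le_reflect:
  assumes "f \<in> weyl" "i \<in> I" "f (simple_root i) \<in> positive_roots"
  shows "bruhat_le f (f \<circ> reflect i)"
  using assms simple_positive[OF assms(2)] unfolding bruhat_step_def reflect_refl_root by blast

lemma bruhat_le_up: "f \<in> weyl \<Longrightarrow> i \<in> I \<Longrightarrow> bruhat_le f (up f i)"
  unfolding up_def using bruhat_le_reflect by simp

lemma comp_reflect_reflect: "i \<in> I \<Longrightarrow> f \<circ> reflect i \<circ> reflect i = f"
  by (rule ext) (simp add: reflect_reflect)

lemma bruhat_le_reflect_up:
  assumes "f \<in> weyl" "i \<in> I"
  shows "bruhat_le (f \<circ> reflect i) (up f i)"
proof (cases "f (simple_root i) \<in> positive_roots")
  case False
  then have "- f (simple_root i) \<in> positive_roots"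
    using positive_root_iff[OF weyl_roots[OF assms(1) simple_root_in_roots[OF assms(2)]]] by blast
  then have "(f \<circ> reflect i) (simple_root i) \<in> positive_roots"
    using assms by (simp add: reflect_simple weyl_minus[OF assms(1)])
  then have "bruhat_le (f \<circ> reflect i) (f \<circ> reflect i \<circ> reflect i)"
    using assms by (intro bruhat_le_reflect weyl_comp weyl_reflect) auto
  then show ?thesis using False assms(2) by (simp add: up_def comp_reflect_reflect)
qed (simp add: up_def)

text \<open>Multiplying both ends by \<open>reflect i\<close> conjugates the reflection of the step,
  whose root stays positive unless it is \<open>simple_root i\<close>; in that case both sides
  become \<open>g\<close>.\<close>

lemma bruhat_step_up:
  assumes fg: "bruhat_step f g" and i: "i \<in> I"
  shows "bruhat_le (up f i) (up g i)"
proof -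
  obtain \<beta> where f: "f \<in> weyl" and \<beta>: "\<beta> \<in> positive_roots" "f \<beta> \<in> positive_roots"
    and g_eq: "g = f \<circ> refl_root \<beta>" using fg by (auto simp: bruhat_step_def)
  have g: "g \<in> weyl" using fg bruhat_step_weyl by blast
  show ?thesis
  proof (cases "\<beta> = simple_root i")
    case True
    then have "g = f \<circ> reflect i" by (simp add: g_eq reflect_refl_root)
    moreover from this have "g (simple_root i) = - f (simple_root i)"
      using i by (simp add: reflect_simple weyl_minus[OF f])
    ultimately have "up f i = g" "up g i = g"
      using True \<beta> minus_positive by (simp_all add: up_def)
    then show ?thesis by simp
  next
    case False
    have "refl_root (reflect i \<beta>) (reflect i \<gamma>) = reflect i (refl_root \<beta> \<gamma>)" for \<gamma>
      using weyl_refl_root[OF weyl_reflect[OF i]] by simp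
    then have "f \<circ> reflect i \<circ> refl_root (reflect i \<beta>) = g \<circ> reflect i"
      unfolding g_eq using i by (intro ext) (metis comp_apply reflect_reflect)
    moreover have "reflect i \<beta> \<in> positive_roots" using reflect_positive \<beta> i False by blast
    moreover have "(f \<circ> reflect i) (reflect i \<beta>) \<in> positive_roots" using \<beta> i by (simp add: reflect_reflect)
    ultimately have "bruhat_step (f \<circ> reflect i) (g \<circ> reflect i)"
      unfolding bruhat_step_def using weyl_comp[OF f weyl_reflect[OF i]] by metis
    then have "bruhat_le (f \<circ> reflect i) (up g i)"
      using bruhat_le_reflect_up[OF g i] by (rule converse_rtranclp_into_rtranclp)
    moreover have "bruhat_le f (up g i)"
      using fg bruhat_le_up[OF g i] by (rule converse_rtranclp_into_rtranclp)
    ultimately show ?thesis unfolding up_def[of f i] by simp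
  qed
qed

lemma bruhat_le_weyl: "bruhat_le f g \<Longrightarrow> f \<in> weyl \<Longrightarrow> g \<in> weyl"
  by (induction rule: rtranclp_induct) (auto intro: bruhat_step_weyl)

lemma bruhat_le_up_up:
  assumes "bruhat_le f g" "i \<in> I"
  shows "bruhat_le (up f i) (up g i)"
  using assms(1)
proof (induction rule: rtranclp_induct)
  case (step g h)
  show ?case by (rule rtranclp_trans[OF step.IH bruhat_step_up[OF step.hyps(2) assms(2)]])
qed simp

text \<open>From \<open>f = g = id\<close>: the Demazure product of a word lies above the product of
  every subword. Starting at a general pair makes the induction go through.\<close>

lemma subword_bruhat_le:
  "subseq zs ys \<Longrightarrow> ys \<in> lists I \<Longrightarrow> f \<in> weyl \<Longrightarrow> bruhat_le f g \<Longrightarrow>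
    bruhat_le (f \<circ> wact zs) (foldl up g ys)"
proof (induction arbitrary: f g rule: list_emb.induct)
  case (list_emb_Nil ys)
  then show ?case
  proof (induction ys arbitrary: g rule: list.induct)
    case (Cons y ys)
    have "y \<in> I" "ys \<in> lists I" using Cons.prems(1) by simp_all
    have "bruhat_le f (up g y)"
      by (rule rtranclp_trans[OF Cons.prems(3)])
        (rule bruhat_le_up[OF bruhat_le_weyl[OF Cons.prems(3,2)] \<open>y \<in> I\<close>])
    from Cons.IH[OF \<open>ys \<in> lists I\<close> Cons.prems(2) this] show ?case by simp
  qed simp
next
  case (list_emb_Cons zs ys y)
  have y: "y \<in> I" "ys \<in> lists I" using list_emb_Cons.prems(1) by simp_all
  have "bruhat_le f (up g y)"
    by (rule rtranclp_trans[OF list_emb_Cons.prems(3)])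
      (rule bruhat_le_up[OF bruhat_le_weyl[OF list_emb_Cons.prems(3,2)] y(1)])
  from list_emb_Cons.IH[OF y(2) list_emb_Cons.prems(2) this] show ?case by simp
next
  case (list_emb_Cons2 z y zs ys)
  have y: "y \<in> I" "ys \<in> lists I" "z = y" using list_emb_Cons2 by simp_all
  have "bruhat_le (f \<circ> reflect y) (up g y)"
    by (rule rtranclp_trans[OF bruhat_le_reflect_up[OF list_emb_Cons2.prems(2) y(1)]])
      (rule bruhat_le_up_up[OF list_emb_Cons2.prems(3) y(1)])
  from list_emb_Cons2.IH[OF y(2) weyl_comp[OF list_emb_Cons2.prems(2) weyl_reflect[OF y(1)]] this]
  show ?case by (simp add: y(3) comp_assoc)
qed

lemma foldl_up_reduced:
  assumes "\<And>us i vs. ws = us @ i # vs \<Longrightarrow> wact us (simple_root i) \<in> positive_roots"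
  shows "foldl up id ws = wact ws"
  using assms
proof (induction ws rule: rev_induct)
  case (snoc i ws)
  have "foldl up id ws = wact ws"
  proof (rule snoc.IH)
    fix us j vs assume "ws = us @ j # vs"
    then show "wact us (simple_root j) \<in> positive_roots" using snoc.prems[of us j "vs @ [i]"] by simp
  qed
  moreover have "wact ws (simple_root i) \<in> positive_roots" using snoc.prems[of ws i "[]"] by simp
  ultimately have "foldl up id (ws @ [i]) = wact ws \<circ> reflect i" by (simp add: up_def[of "wact ws"])
  then show ?case by (simp only:) (rule ext, simp)
qed simp

text \<open>The sign of \<beta> turns negative at some letter \<open>z\<close>. There its image is
  \<open>simple_root z\<close>, and multiplying by the reflection deletes that letter.\<close>

lemma strong_exchange:
  assumes "zs \<in> lists I" "\<beta> \<in> positive_roots" "wact zs \<beta> \<notin> positive_roots"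
  obtains zs' where "subseq zs' zs" "wact zs \<circ> refl_root \<beta> = wact zs'"
proof -
  have "\<exists>zs'. subseq zs' zs \<and> wact zs \<circ> refl_root \<beta> = wact zs'"
    using assms(1,3)
  proof (induction zs rule: list.induct)
    case Nil
    then show ?case using assms(2) by simp
  next
    case (Cons z zs)
    have z: "z \<in> I" "zs \<in> lists I" using Cons.prems(1) by simp_all
    show ?case
    proof (cases "wact zs \<beta> \<in> positive_roots")
      case True
      then have eq: "wact zs \<beta> = simple_root z" using reflect_positive[OF True z(1)] Cons.prems(2) by auto
      have "wact zs (refl_root \<beta> \<gamma>) = reflect z (wact zs \<gamma>)" for \<gamma>
        unfolding weyl_refl_root[OF weyl_wact[OF z(2)]] eq reflect_refl_root ..
      then have "wact (z # zs) \<circ> refl_root \<beta> = wact zs"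
        using z(1) by (intro ext) (simp add: reflect_reflect)
      moreover have "subseq zs (z # zs)" by auto
      ultimately show ?thesis by blast
    next
      case False
      then obtain zs' where zs': "subseq zs' zs" "wact zs \<circ> refl_root \<beta> = wact zs'"
        using Cons.IH z(2) by blast
      have "wact zs (refl_root \<beta> \<gamma>) = wact zs' \<gamma>" for \<gamma>
        using fun_cong[OF zs'(2), of \<gamma>] by simp
      then have "wact (z # zs) \<circ> refl_root \<beta> = wact (z # zs')" by (intro ext) simp
      moreover have "subseq (z # zs') (z # zs)" using zs'(1) by simp
      ultimately show ?thesis by blast
    qed
  qed
  then show thesis using that by blast
qed

text \<open>Each step down in the order deletes a letter by strong exchange; \<open>ys\<close> may
  be any word for \<open>g\<close>.\<close>

lemma bruhat_le_subword:
  assumes "bruhat_le f g" "g = wact ys" "ys \<in> lists I"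
  shows "\<exists>zs. subseq zs ys \<and> f = wact zs"
  using assms(1)
proof (induction rule: converse_rtranclp_induct)
  case base
  show ?case using assms(2) by blast
next
  case (step f h)
  obtain zs where zs: "subseq zs ys" "h = wact zs" using step.IH by blast
  have zsI: "zs \<in> lists I" by (rule subseq_lists[OF zs(1) assms(3)])
  obtain \<beta> where f: "f \<in> weyl" and \<beta>: "\<beta> \<in> positive_roots" "f \<beta> \<in> positive_roots"
    and h: "h = f \<circ> refl_root \<beta>" using step.hyps(1) by (auto simp: bruhat_step_def)
  have unit: "B \<beta> \<beta> = 1" using B_root positive_rootsD \<beta> by blast
  have "wact zs \<beta> = - f \<beta>" unfolding zs(2)[symmetric] h by (simp add: refl_root_self[OF unit] weyl_minus[OF f])
  then have "wact zs \<beta> \<notin> positive_roots" using minus_positive[OF \<beta>(2)] by simp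
  then obtain zs' where "subseq zs' zs" "wact zs \<circ> refl_root \<beta> = wact zs'"
    using strong_exchange[OF zsI \<beta>(1)] by blast
  moreover have "h \<circ> refl_root \<beta> = f" unfolding h by (rule ext) (simp add: refl_root_invol[OF unit])
  ultimately show ?case using zs subseq_order.trans by metis
qed

text \<open>A subword of a reduced word for \<open>c\<close> is below \<open>c\<close> in Bruhat
  order, hence a subword of any word for \<open>c\<close> has the same product. This lets
  \<open>M\<close> and promotion use different words.\<close>

lemma subword_reduced:
  assumes "reduced_word red c" "us \<in> lists I" "word_prod us = c" "subseq zs red"
  obtains zs' where "subseq zs' us" "wact zs' = wact zs"
proof -
  have red: "red \<in> lists I" "word_prod red = c" using assms(1) by (simp_all add: reduced_word_def)
  have "foldl up id red = wact red"
    using reduced_word_prefix_positive assms(1) by (intro foldl_up_reduced) simp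
  also have "\<dots> = wact us" by (rule wact_cong[OF red(1) assms(2)]) (simp add: red assms(3))
  finally have "bruhat_le (wact zs) (wact us)"
    using subword_bruhat_le[OF assms(4) red(1) weyl_id rtranclp.rtrancl_refl] by simp
  then show thesis using bruhat_le_subword[OF _ HOL.refl assms(2)] that by metis
qed

lemma subword_power:
  assumes "reduced_word red c" "us \<in> lists I" "word_prod us = c"
  shows "subseq zs (concat (replicate k red)) \<Longrightarrow>
    \<exists>zs'. subseq zs' (concat (replicate k us)) \<and> wact zs' = wact zs"
proof (induction k arbitrary: zs)
  case 0
  then show ?case by (intro exI[of _ zs]) simp
next
  case (Suc k)
  then have "subseq zs (red @ concat (replicate k red))" by simp
  then obtain zs1 zs2 where zs: "zs = zs1 @ zs2" "subseq zs1 red" "subseq zs2 (concat (replicate k red))"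
    by (rule subseq_appendE)
  obtain zs1' where 1: "subseq zs1' us" "wact zs1' = wact zs1" using subword_reduced[OF assms zs(2)] .
  obtain zs2' where 2: "subseq zs2' (concat (replicate k us))" "wact zs2' = wact zs2" using Suc.IH[OF zs(3)] by blast
  show ?case
    using list_emb_append_mono[OF 1(1) 2(1)] 1(2) 2(2) zs(1) by (intro exI[of _ "zs1' @ zs2'"]) simp
qed

section \<open>Greedy words of powers of a Coxeter element\<close>

lemma wact_coordinate: "i \<notin> set ws \<Longrightarrow> wact ws \<beta> i = \<beta> i"
  by (induction ws) (auto simp: reflect_def simple_root_def)

lemma reduced_word_coxeter_letters:
  assumes "coxeter_ordering us c" "reduced_word red c"
  shows "set red = I"
proof
  have red: "red \<in> lists I" "word_prod red = c" using assms(2) by (simp_all add: reduced_word_def)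
  then show "set red \<subseteq> I" by auto
  show "I \<subseteq> set red"
  proof
    fix i assume i: "i \<in> I"
    have us: "us \<in> lists I" "distinct us" "set us = I" "word_prod us = c"
      using assms(1) by (auto simp: coxeter_ordering_def)
    then obtain ps qs where pq: "us = ps @ i # qs" using i split_list by metis
    have qsI: "qs \<in> lists I" and i_notin: "i \<notin> set ps" "i \<notin> set qs" using us pq by auto
    \<comment> \<open>Chosen so that the suffix \<open>qs\<close> carries it to
      \<open>simple_root i\<close>, whose coordinate the letter \<open>i\<close> turns from 1 into
      -1; no other letter of \<open>us\<close> affects that coordinate.\<close>
    define \<beta> where "\<beta> = wact (rev qs) (simple_root i)"
    have "\<beta> i = 1" using wact_coordinate[of i "rev qs" "simple_root i"] i_notin by (simp add: \<beta>_def simple_root_def)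
    have "wact us \<beta> i = (reflect i (wact qs \<beta>)) i"
      using wact_coordinate[OF i_notin(1)] pq by simp
    also have "\<dots> = - 1"
      unfolding \<beta>_def wact_rev'[OF qsI] reflect_simple[OF i] by (simp add: simple_root_def)
    also have "wact us = wact red" by (rule wact_cong[OF us(1) red(1)]) (simp add: red us)
    finally have "wact red \<beta> i \<noteq> \<beta> i" using \<open>\<beta> i = 1\<close> by simp
    then show "i \<in> set red" using wact_coordinate by metis
  qed
qed

text \<open>One letter is taken from each copy. This shows that the minimum defining
  \<open>M\<close> exists.\<close>

lemma subseq_power: "set ws \<subseteq> set xs \<Longrightarrow> subseq ws (concat (replicate (length ws) xs))"
proof (induction ws)
  case (Cons w ws)
  then have "subseq [w] xs" by (simp add: subseq_singleton_left)
  then have "subseq ([w] @ ws) (xs @ concat (replicate (length ws) xs))"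
    using Cons by (intro list_emb_append_mono) auto
  then show ?case by simp
qed simp

lemma greedy_foldl: "greedy xs t = foldl up id (map (letter xs) [0..<t])"
  by (induction t) simp_all

lemma map_letter: "xs \<noteq> [] \<Longrightarrow> map (letter xs) [0..<k * length xs] = concat (replicate k xs)"
proof (induction k)
  case (Suc k)
  define n where "n = length xs"
  have "map (letter xs) [k * n..<k * n + n] = xs"
    using Suc.prems by (intro nth_equalityI) (simp_all add: n_def letter_def hd_rotate_conv_nth)
  moreover have "[0..<Suc k * n] = [0..<k * n] @ [k * n..<k * n + n]"
    using upt_add_eq_append[of 0 "k * n" n] by (simp add: add.commute)
  ultimately have "map (letter xs) [0..<Suc k * n] = concat (replicate k xs) @ xs"
    using Suc by (simp add: n_def)
  also have "\<dots> = concat (replicate (Suc k) xs)"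
    using arg_cong[OF replicate_append_same[of k xs], of concat] by simp
  finally show ?case by (simp add: n_def)
qed simp

text \<open>The reversed word acts as the inverse. It is needed because the rightmost toggle of a
  word acts first.\<close>

lemma negating_rev:
  assumes "ws \<in> lists I" "negating (wact ws)"
  shows "negating (wact (rev ws))"
  unfolding negating_def
proof (intro conjI ballI)
  have "rev ws \<in> lists I" using assms(1) by auto
  then show "wact (rev ws) \<in> weyl" by (rule weyl_wact)
  fix i assume i: "i \<in> I"
  show "wact (rev ws) (simple_root i) \<notin> positive_roots"
    using negating_positive[OF assms(2), of "wact (rev ws) (simple_root i)"]
      simple_positive[OF i] wact_rev'[OF assms(1)] by metis
qed

lemma negating_bruhat_maximal:
  assumes "negating f" "bruhat_le f g" shows "g = f"
  using assms(2)
proof (cases rule: converse_rtranclpE)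
  case (step h)
  then show ?thesis using negating_positive[OF assms(1)] by (auto simp: bruhat_step_def)
qed simp

text \<open>A word for the long element in the power of \<open>red\<close> is transferred to the
  power of \<open>us\<close> and reversed. The Demazure product of the reversed power lies above it
  and equals it by maximality.\<close>

lemma negating_greedy:
  assumes "coxeter_ordering us c" "reduced_word red c" "I \<noteq> {}"
  shows "negating (greedy (rev us) (M red * length us))"
proof -
  have us: "us \<in> lists I" "set us = I" "word_prod us = c"
    using assms(1) by (auto simp: coxeter_ordering_def)
  define k where "k = M red"
  obtain ws0 where ws0: "reduced_word ws0 long_element" using ex_reduced_word long_element_closed by blast
  then have "set ws0 \<subseteq> set red"
    unfolding reduced_word_coxeter_letters[OF assms(1,2)] by (auto simp: reduced_word_def)
  then have "subseq ws0 (red @ concat (replicate (length ws0) red))"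
    using subseq_power by (intro list_emb_append2) blast
  then have "\<exists>k. 0 < k \<and> (\<exists>ws. reduced_word ws long_element \<and> subseq ws (concat (replicate k red)))"
    using ws0 by (intro exI[of _ "Suc (length ws0)"]) auto
  from LeastI_ex[OF this] obtain ws
    where ws: "reduced_word ws long_element" "subseq ws (concat (replicate k red))"
    unfolding k_def M_def by blast
  obtain vs where vs: "subseq vs (concat (replicate k us))" "wact vs = wact ws"
    using subword_power[OF assms(2) us(1,3) ws(2)] by blast
  have pow_us: "concat (replicate k us) \<in> lists I" using us(1) by (induction k) auto
  have vsI: "vs \<in> lists I" by (rule subseq_lists[OF vs(1) pow_us])
  have "wact ws = act long_element" using ws(1) act_word_prod[of ws] unfolding reduced_word_def by metis
  then have neg: "negating (wact (rev vs))"
    using negating_long_element negating_rev[OF vsI] vs(2) by simp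
  define xs where "xs = rev us"
  have xs: "xs \<noteq> []" "length xs = length us" using us(2) assms(3) by (auto simp: xs_def)
  have pow: "concat (replicate k xs) = rev (concat (replicate k us))"
    by (simp add: xs_def rev_concat)
  have sub: "subseq (rev vs) (concat (replicate k xs))" unfolding pow by (rule subseq_rev[OF vs(1)])
  have powI: "concat (replicate k xs) \<in> lists I"
    unfolding pow using pow_us by (simp only: in_lists_conv_set set_rev)
  have "bruhat_le (wact (rev vs)) (foldl up id (concat (replicate k xs)))"
    using subword_bruhat_le[OF sub powI weyl_id rtranclp.rtrancl_refl] by simp
  then have "foldl up id (concat (replicate k xs)) = wact (rev vs)"
    using negating_bruhat_maximal[OF neg] by blast
  then show ?thesis
    using neg unfolding greedy_foldl xs(2)[symmetric] xs_def[symmetric] k_def[symmetric] map_letter[OF xs(1)] by simp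
qed

end

section \<open>Noninvertible toggles\<close>

locale convex_billiards = finite_coxeter_system G I s
  for G (structure) and I :: "'i set" and s :: "'i \<Rightarrow> 'a" +
  fixes L :: "'a set"
  assumes convex: "convex_subset L" and nonempty: "L \<noteq> {}"
begin

lemma R_root: "\<beta> \<in> R L \<Longrightarrow> \<beta> \<in> roots"
  by (simp add: R_def)

lemma R_positive: "\<beta> \<in> R L \<Longrightarrow> v \<in> L \<Longrightarrow> act v \<beta> \<in> positive_roots"
  by (auto simp: R_def half_space_def)

lemma L_closed: "v \<in> L \<Longrightarrow> v \<in> carrier G"
  using convex by (auto simp: convex_subset_def)

text \<open>The roots that define a convex set belong to \<open>R L\<close>, so \<open>R L\<close>
  recovers the set.\<close>

lemma L_iff: "u \<in> L \<longleftrightarrow> u \<in> carrier G \<and> (\<forall>\<beta>\<in>R L. act u \<beta> \<in> positive_roots)"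
proof
  assume u: "u \<in> carrier G \<and> (\<forall>\<beta>\<in>R L. act u \<beta> \<in> positive_roots)"
  obtain A where A: "A \<subseteq> roots" "L = carrier G \<inter> (\<Inter>\<beta>\<in>A. half_space \<beta>)"
    using convex by (auto simp: convex_subset_def)
  then have "A \<subseteq> R L" by (auto simp: R_def)
  then have "u \<in> half_space \<beta>" if "\<beta> \<in> A" for \<beta> using u that by (auto simp: half_space_def)
  then show "u \<in> L" using u A(2) by blast
qed (use R_positive L_closed in blast)

lemma R_lincomb:
  assumes "\<beta> \<in> R L" "\<gamma> \<in> R L" "a \<ge> 0" "b \<ge> 0" "lincomb a \<beta> b \<gamma> \<in> roots"
  shows "lincomb a \<beta> b \<gamma> \<in> R L"
proof -
  have "v \<in> half_space (lincomb a \<beta> b \<gamma>)" if v: "v \<in> L" for v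
  proof -
    have w: "act v \<in> weyl" using weyl_act L_closed v by blast
    have "lincomb a (act v \<beta>) b (act v \<gamma>) \<in> roots"
      using weyl_roots[OF w assms(5)] unfolding weyl_lincomb[OF w] .
    then have "lincomb a (act v \<beta>) b (act v \<gamma>) \<in> positive_roots"
      using positive_lincomb[OF R_positive[OF assms(1) v] R_positive[OF assms(2) v] assms(3,4)] by blast
    then show ?thesis using L_closed[OF v] by (simp add: half_space_def weyl_lincomb[OF w])
  qed
  then show ?thesis using assms(5) by (auto simp: R_def)
qed

lemma R_minus: "\<beta> \<in> R L \<Longrightarrow> - \<beta> \<notin> R L"
proof
  assume b: "\<beta> \<in> R L" "- \<beta> \<in> R L"
  obtain v where v: "v \<in> L" using nonempty by blast
  have "- act v \<beta> \<in> positive_roots"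
    using R_positive[OF b(2) v] by (simp add: weyl_minus[OF weyl_act[OF L_closed[OF v]]])
  then show False using minus_positive[OF R_positive[OF b(1) v]] by blast
qed

lemma toggle_closed: "u \<in> carrier G \<Longrightarrow> i \<in> I \<Longrightarrow> toggle L i u \<in> carrier G"
  by (simp add: toggle_def)

lemma act_eq_simple_iff:
  "u \<in> carrier G \<Longrightarrow> act u \<beta> = simple_root i \<longleftrightarrow> \<beta> = act (inv u) (simple_root i)"
  by (metis act_act_inv act_inv_act)

lemma act_s_mult: "u \<in> carrier G \<Longrightarrow> i \<in> I \<Longrightarrow> act (s i \<otimes> u) \<beta> = reflect i (act u \<beta>)"
  by (simp add: act_mult act_s)

text \<open>The invariant of the proof, where \<open>f\<close> is the greedy product.\<close>

definition sorted_by :: "(('i \<Rightarrow> real) \<Rightarrow> ('i \<Rightarrow> real)) \<Rightarrow> 'a \<Rightarrow> bool" where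
  "sorted_by f u \<longleftrightarrow> (\<forall>\<beta>\<in>R L. act u \<beta> \<in> positive_roots \<or> f (act u \<beta>) \<notin> positive_roots)"

lemma reflect_negative:
  assumes "\<gamma> \<in> roots" "i \<in> I" "\<gamma> \<notin> positive_roots" "\<gamma> \<noteq> - simple_root i"
  shows "reflect i \<gamma> \<notin> positive_roots"
proof -
  have "- \<gamma> \<in> positive_roots" using assms positive_root_iff by blast
  moreover have "- \<gamma> \<noteq> simple_root i" using assms(4) by (metis minus_minus_root)
  ultimately have "reflect i (- \<gamma>) \<in> positive_roots" using reflect_positive assms(2) by blast
  then show ?thesis
    using minus_positive unfolding weyl_minus[OF weyl_reflect[OF assms(2)]] by force
qed

text \<open>If the toggle moves \<open>u\<close>, the two reflections cancel under \<open>f\<close>,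
  and positive roots stay positive. If it does not, \<open>simple_root i\<close> itself lies in the
  image of \<open>R L\<close> under \<open>u\<close>, and the sign of
  \<open>B \<gamma> (simple_root i)\<close> decides how this is exploited.\<close>

lemma sorted_by_used:
  assumes f: "f \<in> weyl" and u: "u \<in> carrier G" and i: "i \<in> I"
    and pos: "f (simple_root i) \<in> positive_roots" and srt: "sorted_by f u"
  shows "sorted_by (f \<circ> reflect i) (toggle L i u)"
  unfolding sorted_by_def
proof (intro ballI)
  fix \<beta> assume \<beta>: "\<beta> \<in> R L"
  define \<gamma> where "\<gamma> = act u \<beta>"
  have \<gamma>: "\<gamma> \<in> roots" unfolding \<gamma>_def by (rule weyl_roots[OF weyl_act[OF u] R_root[OF \<beta>]])
  have srt_\<gamma>: "\<gamma> \<in> positive_roots \<or> f \<gamma> \<notin> positive_roots" using srt \<beta> by (auto simp: sorted_by_def \<gamma>_def)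
  define \<delta> where "\<delta> = act (inv u) (simple_root i)"
  have u\<delta>: "act u \<delta> = simple_root i" using u by (simp add: \<delta>_def act_act_inv)
  show "act (toggle L i u) \<beta> \<in> positive_roots \<or> (f \<circ> reflect i) (act (toggle L i u) \<beta>) \<notin> positive_roots"
  proof (cases "\<delta> \<in> R L")
    case True
    have tog: "toggle L i u = u" using True by (simp add: toggle_def \<delta>_def)
    have "f (reflect i \<gamma>) \<notin> positive_roots" if neg: "\<gamma> \<notin> positive_roots"
    proof (cases "B \<gamma> (simple_root i) \<ge> 0")
      case True
      have f\<gamma>: "f \<gamma> \<in> roots" by (rule weyl_roots[OF f \<gamma>])
      \<comment> \<open>Positivity of \<open>f (reflect i \<gamma>)\<close> would pass to
        \<open>f \<gamma>\<close>, against the invariant for \<gamma>.\<close>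
      have eq: "f \<gamma> = lincomb 1 (f (reflect i \<gamma>)) (2 * B \<gamma> (simple_root i)) (f (simple_root i))"
        unfolding reflect_lincomb weyl_lincomb[OF f] by (simp add: lincomb_def)
      show ?thesis
      proof
        assume "f (reflect i \<gamma>) \<in> positive_roots"
        from positive_lincomb[OF this pos, of 1 "2 * B \<gamma> (simple_root i)"] True f\<gamma>
        have "f \<gamma> \<in> positive_roots" unfolding eq[symmetric] by simp
        then show False using srt_\<gamma> neg by blast
      qed
    next
      case False
      \<comment> \<open>The preimage of \<open>reflect i \<gamma>\<close> under \<open>u\<close>.
        Its coefficients are nonnegative, so it lies in \<open>R L\<close> and the invariant applies
        to it.\<close>
      define \<beta>' where "\<beta>' = lincomb 1 \<beta> (- 2 * B \<gamma> (simple_root i)) \<delta>"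
      have eq: "act u \<beta>' = reflect i \<gamma>"
        unfolding \<beta>'_def weyl_lincomb[OF weyl_act[OF u]] u\<delta> reflect_lincomb \<gamma>_def[symmetric] ..
      have "reflect i \<gamma> \<in> roots" by (rule weyl_roots[OF weyl_reflect[OF i] \<gamma>])
      then have "\<beta>' \<in> roots" unfolding eq[symmetric] weyl_roots_iff[OF weyl_act[OF u]] .
      then have "\<beta>' \<in> R L"
        unfolding \<beta>'_def using R_lincomb[OF \<beta> True] False by simp
      then have srt': "reflect i \<gamma> \<in> positive_roots \<or> f (reflect i \<gamma>) \<notin> positive_roots"
        using srt eq unfolding sorted_by_def by metis
      have "\<gamma> \<noteq> - simple_root i"
      proof
        assume "\<gamma> = - simple_root i"
        then have "act u (- \<beta>) = simple_root i" by (simp add: weyl_minus[OF weyl_act[OF u]] \<gamma>_def[symmetric])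
        then have "- \<beta> = \<delta>" using act_eq_simple_iff[OF u] by (simp add: \<delta>_def)
        then show False using True R_minus[OF \<beta>] by simp
      qed
      then show ?thesis using reflect_negative[OF \<gamma> i neg] srt' by blast
    qed
    then show ?thesis unfolding tog \<gamma>_def[symmetric] comp_apply by blast
  next
    case False
    have tog: "act (toggle L i u) \<beta> = reflect i \<gamma>"
      using False u i by (simp add: toggle_def \<delta>_def act_s_mult \<gamma>_def)
    have "\<gamma> \<noteq> simple_root i"
      using False \<beta> act_eq_simple_iff[OF u, of \<beta> i] by (auto simp: \<delta>_def \<gamma>_def)
    then have "\<gamma> \<in> positive_roots \<Longrightarrow> reflect i \<gamma> \<in> positive_roots" using reflect_positive i by blast
    then show ?thesis unfolding tog comp_apply reflect_reflect[OF i] using srt_\<gamma> by blast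
  qed
qed

text \<open>Here \<open>f\<close> conjugates \<open>reflect i\<close> to \<open>reflect j\<close>,
  which keeps negative roots negative except \<open>- simple_root j\<close>. That root would come
  from \<gamma> equal to \<open>simple_root i\<close>, which is excluded when the toggle
  moves.\<close>

lemma sorted_by_skip:
  assumes f: "f \<in> weyl" and u: "u \<in> carrier G" and i: "i \<in> I" and j: "j \<in> I"
    and simple: "f (simple_root i) = - simple_root j" and srt: "sorted_by f u"
  shows "sorted_by f (toggle L i u)"
proof (cases "act (inv u) (simple_root i) \<in> R L")
  case True
  then show ?thesis using srt by (simp add: toggle_def)
next
  case False
  show ?thesis
    unfolding sorted_by_def
  proof (intro ballI)
    fix \<beta> assume \<beta>: "\<beta> \<in> R L"
    define \<gamma> where "\<gamma> = act u \<beta>"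
    have \<gamma>: "\<gamma> \<in> roots" unfolding \<gamma>_def by (rule weyl_roots[OF weyl_act[OF u] R_root[OF \<beta>]])
    have srt_\<gamma>: "\<gamma> \<in> positive_roots \<or> f \<gamma> \<notin> positive_roots" using srt \<beta> by (auto simp: sorted_by_def \<gamma>_def)
    have tog: "act (toggle L i u) \<beta> = reflect i \<gamma>"
      using False u i by (simp add: toggle_def act_s_mult \<gamma>_def)
    have ne: "\<gamma> \<noteq> simple_root i"
      using False \<beta> act_eq_simple_iff[OF u, of \<beta> i] by (auto simp: \<gamma>_def)
    have "f (reflect i \<gamma>) \<notin> positive_roots" if neg: "\<gamma> \<notin> positive_roots"
    proof -
      have "f \<gamma> \<noteq> - simple_root j"
      proof
        assume "f \<gamma> = - simple_root j"
        then have "f \<gamma> = f (simple_root i)" by (simp only: simple)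
        moreover obtain g where "\<And>\<beta>. g (f \<beta>) = \<beta>" using weyl_inverse[OF f] by metis
        ultimately have "\<gamma> = simple_root i" by metis
        then show False using ne by blast
      qed
      then have "reflect j (f \<gamma>) \<notin> positive_roots"
        using reflect_negative[OF weyl_roots[OF f \<gamma>] j] srt_\<gamma> neg by blast
      moreover have "f (reflect i \<gamma>) = reflect j (f \<gamma>)"
        unfolding reflect_refl_root weyl_refl_root[OF f] simple
        by (simp add: refl_root_def lincomb_def B_minus_right)
      ultimately show ?thesis by simp
    qed
    then show "act (toggle L i u) \<beta> \<in> positive_roots \<or> f (act (toggle L i u) \<beta>) \<notin> positive_roots"
      unfolding tog using reflect_positive[OF _ i ne] by blast
  qed
qed

section \<open>Iterated toggles along the greedy word\<close>

lemma toggles_closed: "is \<in> lists I \<Longrightarrow> u \<in> carrier G \<Longrightarrow> foldl (\<lambda>u i. toggle L i u) u is \<in> carrier G"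
  by (induction "is" arbitrary: u) (auto simp: toggle_closed)

lemma sorted_by_greedy:
  assumes ord: "ordering xs" and neg: "negating (greedy xs T)" and u: "u \<in> carrier G" and t: "t \<le> T"
  shows "sorted_by (greedy xs t) (foldl (\<lambda>u i. toggle L i u) u (map (letter xs) [0..<t]))"
  using t
proof (induction t)
  case 0
  then show ?case by (auto simp: sorted_by_def)
next
  case (Suc t)
  define v where "v = foldl (\<lambda>u i. toggle L i u) u (map (letter xs) [0..<t])"
  have "map (letter xs) [0..<t] \<in> lists I" using letter_mem[OF ord] by auto
  then have v: "v \<in> carrier G" unfolding v_def using u by (rule toggles_closed)
  have step: "foldl (\<lambda>u i. toggle L i u) u (map (letter xs) [0..<Suc t]) = toggle L (letter xs t) v"
    by (simp add: v_def)
  have IH: "sorted_by (greedy xs t) v" using Suc by (simp add: v_def)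
  show ?case
  proof (cases "used xs t")
    case True
    then have "greedy xs t (simple_root (letter xs t)) \<in> positive_roots" by (simp add: used_def)
    then show ?thesis unfolding step greedy_used[OF True]
      using sorted_by_used[OF greedy_weyl[OF ord] v letter_mem[OF ord] _ IH] by blast
  next
    case False
    have "t < T" using Suc.prems by simp
    then obtain j where "j \<in> I" "greedy xs t (simple_root (letter xs t)) = - simple_root j"
      using skip_simple[OF ord neg _ False] by metis
    then show ?thesis unfolding step greedy_skip[OF False]
      using sorted_by_skip[OF greedy_weyl[OF ord] v letter_mem[OF ord] _ _ IH] by blast
  qed
qed

lemma sorted_by_negating:
  assumes "negating f" "u \<in> carrier G" "sorted_by f u"
  shows "u \<in> L"
  unfolding L_iff
proof (intro conjI ballI)
  fix \<beta> assume \<beta>: "\<beta> \<in> R L"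
  define \<gamma> where "\<gamma> = act u \<beta>"
  have f: "f \<in> weyl" using assms(1) by (simp add: negating_def)
  have \<gamma>: "\<gamma> \<in> roots" unfolding \<gamma>_def by (rule weyl_roots[OF weyl_act[OF assms(2)] R_root[OF \<beta>]])
  have "\<gamma> \<in> positive_roots"
  proof (rule ccontr)
    assume neg: "\<gamma> \<notin> positive_roots"
    then have "f (- \<gamma>) \<notin> positive_roots" using negating_positive[OF assms(1)] positive_root_iff[OF \<gamma>] by blast
    then have "f \<gamma> \<in> positive_roots"
      using positive_root_iff[OF weyl_roots[OF f \<gamma>]] unfolding weyl_minus[OF f] by blast
    then show False using assms(3) \<beta> neg by (auto simp: sorted_by_def \<gamma>_def)
  qed
  then show "act u \<beta> \<in> positive_roots" by (simp add: \<gamma>_def)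
qed (fact assms(2))

text \<open>On \<open>L\<close> each toggle is an involution, so no element of \<open>L\<close> is
  lost under promotion.\<close>

lemma toggle_image:
  assumes i: "i \<in> I" shows "toggle L i ` L = L"
proof -
  have mem: "toggle L i u \<in> L" and invol: "toggle L i (toggle L i u) = u" if u: "u \<in> L" for u
  proof -
    have uG: "u \<in> carrier G" by (rule L_closed[OF u])
    define \<delta> where "\<delta> = act (inv u) (simple_root i)"
    have "toggle L i u \<in> L \<and> toggle L i (toggle L i u) = u"
    proof (cases "\<delta> \<in> R L")
      case True
      then show ?thesis using u by (simp add: toggle_def \<delta>_def)
    next
      case False
      then have tog: "toggle L i u = s i \<otimes> u" by (simp add: toggle_def \<delta>_def)
      have "act (s i \<otimes> u) \<beta> \<in> positive_roots" if \<beta>: "\<beta> \<in> R L" for \<beta>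
      proof -
        have "act u \<beta> \<noteq> simple_root i" using False \<beta> act_eq_simple_iff[OF uG] by (auto simp: \<delta>_def)
        then show ?thesis
          unfolding act_s_mult[OF uG i] using reflect_positive[OF R_positive[OF \<beta> u] i] by blast
      qed
      then have mem: "s i \<otimes> u \<in> L" unfolding L_iff using uG i by simp
      have eq: "act (inv (s i \<otimes> u)) (simple_root i) = - \<delta>"
        using uG i by (simp add: inv_mult_group s_inv act_mult act_s reflect_simple weyl_minus[OF weyl_act] \<delta>_def)
      \<comment> \<open>The element \<open>u\<close> of \<open>L\<close> sends -\<delta> to the
        negative of a simple root, so the second toggle moves back.\<close>
      have "- \<delta> \<notin> R L"
      proof
        assume "- \<delta> \<in> R L"
        from R_positive[OF this u] have "- act u \<delta> \<in> positive_roots" by (simp add: weyl_minus[OF weyl_act[OF uG]])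
        then have "- simple_root i \<in> positive_roots" using uG by (simp add: \<delta>_def act_act_inv)
        then show False using minus_positive[OF simple_positive[OF i]] by blast
      qed
      then have "toggle L i (s i \<otimes> u) = u" unfolding toggle_def eq using s_cancel[OF i uG] by simp
      then show ?thesis using mem by (simp add: tog)
    qed
    then show "toggle L i u \<in> L" "toggle L i (toggle L i u) = u" by blast+
  qed
  show ?thesis
  proof
    show "toggle L i ` L \<subseteq> L" using mem by blast
    show "L \<subseteq> toggle L i ` L"
    proof
      fix u assume "u \<in> L"
      then show "u \<in> toggle L i ` L" using mem invol by (intro image_eqI[of _ _ "toggle L i u"]) auto
    qed
  qed
qed

lemma toggles_image: "is \<in> lists I \<Longrightarrow> foldr (toggle L) is ` L = L"
proof (induction "is" rule: list.induct)
  case (Cons i "is")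
  then have "foldr (toggle L) (i # is) ` L = toggle L i ` L" by (simp only: foldr.simps image_comp[symmetric]) simp
  then show ?case using toggle_image Cons.prems by simp
qed simp

lemma Pro_power: "Pro L is ^^ k = foldr (toggle L) (concat (replicate k is))"
  by (induction k) (simp_all add: Pro_def fun_eq_iff)

theorem Pro_power_image:
  assumes "coxeter_ordering us c" "reduced_word red c"
  shows "(Pro L us ^^ M red) ` carrier G = L"
proof (cases "I = {}")
  \<comment> \<open>Without letters the group is trivial, so a nonempty \<open>L\<close> is all of
    it. The periodic word needs a nonempty ordering.\<close>
  case True
  have "us = []" using assms(1) unfolding coxeter_ordering_def by (simp add: True)
  have "v = \<one>" if "v \<in> carrier G" for v
    using ex_word[OF that] True by auto
  then have "carrier G = L" using L_closed nonempty by blast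
  moreover have "Pro L us ^^ M red = id"
    unfolding Pro_power \<open>us = []\<close> by (induction "M red") auto
  ultimately show ?thesis by simp
next
  case False
  define k where "k = M red"
  have us: "us \<in> lists I" "set us = I" "distinct us" using assms(1) by (auto simp: coxeter_ordering_def)
  define xs where "xs = rev us"
  have ord: "ordering xs" using us False by (auto simp: ordering_def xs_def)
  have neg: "negating (greedy xs (k * length xs))"
    using negating_greedy[OF assms False] by (simp add: xs_def k_def)
  have powI: "concat (replicate k us) \<in> lists I" using us(1) by (induction k) auto
  have letters: "map (letter xs) [0..<k * length xs] = rev (concat (replicate k us))"
    using map_letter[of xs k] ord by (simp add: ordering_def xs_def rev_concat)
  have "(Pro L us ^^ k) u \<in> L" if u: "u \<in> carrier G" for u
  proof -
    \<comment> \<open>The composition applies its last letter first, hence the reversal.\<close>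
    have eq: "(Pro L us ^^ k) u = foldl (\<lambda>u i. toggle L i u) u (map (letter xs) [0..<k * length xs])"
      unfolding Pro_power letters by (rule foldr_conv_foldl)
    have "rev (concat (replicate k us)) \<in> lists I" using powI by (simp only: in_lists_conv_set set_rev)
    then have "(Pro L us ^^ k) u \<in> carrier G" unfolding eq letters using u by (rule toggles_closed)
    moreover have "sorted_by (greedy xs (k * length xs)) ((Pro L us ^^ k) u)"
      unfolding eq by (rule sorted_by_greedy[OF ord neg u order_refl])
    ultimately show ?thesis using sorted_by_negating[OF neg] by blast
  qed
  moreover have "(Pro L us ^^ k) ` L = L" unfolding Pro_power by (rule toggles_image[OF powI])
  then have "L \<subseteq> (Pro L us ^^ k) ` carrier G" using L_closed by blast
  ultimately show ?thesis unfolding k_def by blast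
qed

end

text \<open>The ordering that defines promotion and the reduced word that defines \<open>M\<close>
  may be different words for \<open>c\<close>.\<close>

theorem corollary1p24:
  fixes G :: "('a, 'b) monoid_scheme"
    and I :: "'i set" and s :: "'i \<Rightarrow> 'a"
    and c :: 'a and L :: "'a set" and ord_c red_c :: "'i list"
  assumes "coxeter_system G I s"
    and "finite (carrier G)"
    and "coxeter_system.coxeter_element G I s c"
    and "coxeter_system.convex_subset G I s L" and "L \<noteq> {}"
    and "coxeter_system.coxeter_ordering G I s ord_c c"
    and "coxeter_system.reduced_word G I s red_c c"
  shows "(coxeter_system.Pro G I s L ord_c ^^ coxeter_system.M G I s red_c) ` carrier G = L"
proof -
  interpret coxeter_system G I s by (fact assms(1))
  interpret convex_billiards G I s L
    by unfold_locales (use assms in auto)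
  show ?thesis using Pro_power_image assms(6,7) by blast
qed

end
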